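(* For $n\ge 3$ let $\gamma(n)=\max\{\gamma(D): D \text{ is a strongly connected directed graph with } n \text{ vertices}\}$, where $\gamma(D)$ is the principal ratio of the stationary distribution of the simple random walk on $D$. Then for every $n\ge 3$, $$\gamma(n)=\frac{2}{3}\left(\frac{n}{n-1}+\frac{1}{(n-1)!}\sum_{i=1}^{n-3}i!\right)(n-1)!.$$ Moreover, up to isomorphism, $\gamma(n)$ is attained only by the directed graphs $D_1,D_2,D_3$ (each of them attains it), which are defined as follows: each has vertex set $\{v_1,v_2,\ldots,v_n\}$ and edge set $$E(D)=\{(v_i,v_{i+1}): 1\le i\le n-1\}\cup\{(v_j,v_i): 1\le i<j\le n-1\}\cup S(D),$$ where $S(D_1)=\{(v_n,v_1)\}$, $S(D_2)=\{(v_n,v_2)\}$, and $S(D_3)=\{(v_n,v_1),(v_n,v_2)\}$.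
   Context: Directed graphs are simple: no loops and no multiple edges (for $u\ne v$ both $(u,v)$ and $(v,u)$ may be edges). For a vertex $u$, $d^+(u)$ is its out-degree, i.e. the number of $v$ with $(u,v)\in E(D)$. The simple random walk on $D$ has transition probability matrix $P$ with $P(u,v)=1/d^+(u)$ if $(u,v)\in E(D)$ and $P(u,v)=0$ otherwise. For strongly connected $D$, the Perron vector (stationary distribution) is the unique row vector $\phi$ with positive entries, $\phi P=\phi$ and $\sum_u\phi(u)=1$. The principal ratio is $\gamma(D)=\frac{\max_u\phi(u)}{\min_u\phi(u)}$. For $n=3$ the sum $\sum_{i=1}^{n-3}i!$ is empty and equals $0$. *)

theory Defs
  imports Complex_Main "Graph_Theory.Graph_Theory"
begin

definition rw_prob :: "'a pair_pre_digraph \<Rightarrow> 'a \<Rightarrow> 'a \<Rightarrow> real" where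
  "rw_prob D u v =
     (if (u, v) \<in> parcs D then 1 / real (out_degree (with_proj D) u) else 0)"

definition is_perron_vector :: "'a pair_pre_digraph \<Rightarrow> ('a \<Rightarrow> real) \<Rightarrow> bool" where
  "is_perron_vector D \<phi> \<longleftrightarrow>
     (\<forall>u\<in>pverts D. 0 < \<phi> u) \<and>
     (\<forall>v\<in>pverts D. (\<Sum>u\<in>pverts D. \<phi> u * rw_prob D u v) = \<phi> v) \<and>
     (\<Sum>u\<in>pverts D. \<phi> u) = 1"

text \<open>
  A vector indexed by the vertices is a function on the whole vertex type; requiring it to
  vanish outside the vertex set makes the description below unique.
  For digraphs that are not strongly connected it need not determine a vector.
\<close>

definition perron_vector :: "'a pair_pre_digraph \<Rightarrow> 'a \<Rightarrow> real" where
  "perron_vector D = (THE \<phi>. is_perron_vector D \<phi> \<and> (\<forall>u. u \<notin> pverts D \<longrightarrow> \<phi> u = 0))"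

definition principal_ratio :: "'a pair_pre_digraph \<Rightarrow> real" where
  "principal_ratio D =
     Max (perron_vector D ` pverts D) / Min (perron_vector D ` pverts D)"

definition sc_digraphs :: "nat \<Rightarrow> 'a pair_pre_digraph set" where
  "sc_digraphs n =
     {D. pair_digraph D \<and> strongly_connected (with_proj D) \<and> card (pverts D) = n}"

text \<open>
  Every finite digraph is isomorphic to one whose vertices are natural numbers, so it is enough
  to take the maximum over these. There are infinitely many of them, but the principal ratio
  is invariant under isomorphism and therefore takes only finitely many values for fixed
  \<open>n\<close>, so \<^const>\<open>Max\<close> is meaningful.
\<close>

definition max_principal_ratio :: "nat \<Rightarrow> real" where
  "max_principal_ratio n = Max (principal_ratio ` (sc_digraphs n :: nat pair_pre_digraph set))"

text \<open>The vertex \<open>v\<^sub>i\<close> is represented by the number \<open>i\<close>.\<close>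

definition extremal_digraph :: "nat \<Rightarrow> (nat \<times> nat) set \<Rightarrow> nat pair_pre_digraph" where
  "extremal_digraph n S =
     \<lparr> pverts = {1..n},
       parcs = {(i, i + 1) | i. 1 \<le> i \<and> i \<le> n - 1}
             \<union> {(j, i) | i j. 1 \<le> i \<and> i < j \<and> j \<le> n - 1}
             \<union> S \<rparr>"

definition D1 :: "nat \<Rightarrow> nat pair_pre_digraph" where
  "D1 n = extremal_digraph n {(n, 1)}"

definition D2 :: "nat \<Rightarrow> nat pair_pre_digraph" where
  "D2 n = extremal_digraph n {(n, 2)}"

definition D3 :: "nat \<Rightarrow> nat pair_pre_digraph" where
  "D3 n = extremal_digraph n {(n, 1), (n, 2)}"

end

theory Submission
  imports Defs
begin

text \<open>
  Let \<open>s\<close> and \<open>t\<close> be two vertices of a strongly connected digraph with stationary vector \<open>\<phi>\<close>, and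
  let \<open>h u\<close> be the probability that the walk from \<open>u\<close> hits \<open>t\<close> before \<open>s\<close>. Then \<open>h\<close> vanishes at \<open>s\<close>, is
  \<open>1\<close> at \<open>t\<close>, and at every other vertex equals its mean over the out-neighbours. Pairing
  stationarity with \<open>h\<close> cancels all other vertices and leaves
  \<open>\<phi> s * mean h s = \<phi> t * (1 - mean h t)\<close> (\<open>perron_balance_two\<close>). So \<open>\<phi> s / \<phi> t\<close> is at most
  \<open>1 / mean h s\<close>, and the problem becomes to make the escape probability \<open>mean h s\<close> small.

  List the vertices by increasing value of \<open>h\<close> and call the values
  \<open>y 0 = \<dots> = y z = 0 < y (z + 1) \<le> \<dots> \<le> y (n - 1) = 1\<close>, with \<open>s\<close> in position \<open>z\<close>.
  A harmonic vertex with an out-neighbour that lies above it by some amount needs out-neighbours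
  that together lie below it by the same amount, and a digraph without multiple arcs
  offers at most all the lower vertices for that. Strong connectivity forces arcs to go up, whence
  (\<open>level_step\<close>)
  \<open>y (j + 1) - y j \<le> (\<Sum>i<j. y j - y i)\<close> for \<open>j > z\<close>. The same argument at \<open>s\<close>
  gives \<open>y (z + 1) \<le> (z + 1) * mean h s\<close> (\<open>first_level_le\<close>). Iterated, these inequalities bound
  \<open>y (n - 1) = 1\<close> by \<open>mean h s\<close> times a number that depends on \<open>z\<close> and is largest for \<open>z = 1\<close> and,
  if \<open>n = 3\<close>, also for \<open>z = 0\<close>. There it is \<open>2/3 * (1! + \<dots> + (n - 1)!)\<close> (\<open>last_le\<close>), the claimed
  maximum.

  If the bound is attained, every inequality is an equality. The values are then
  strictly increasing from position \<open>z\<close> on, and equality in the local inequality says exactly that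
  the out-neighbours of a vertex are all lower vertices and the next higher one. Finally
  \<open>mean h t = 0\<close> confines the out-neighbours of \<open>t\<close> to the zeros of \<open>h\<close>
  (\<open>staircase_if_minimal_escape\<close>). These are the digraphs \<open>D1\<close>, \<open>D2\<close>, \<open>D3\<close>. That they attain the
  bound follows from the balance identity with their harmonic function written down explicitly
  (\<open>extremal_principal_ratio\<close>).
\<close>

section \<open>Stationary vectors\<close>

text \<open>
  Induction on the number of states, by eliminating a state \<open>x\<close>: the walk watched only while it is
  outside \<open>x\<close> has weights \<open>w u v + w u x * w x v / W\<close>, where \<open>W\<close> is the total weight out of \<open>x\<close>. A
  stationary vector of the smaller system extends to \<open>x\<close> by solving the balance equation at \<open>x\<close>. If
  \<open>W = 0\<close> the state is absorbing and its indicator is stationary. Weights on the diagonal cancel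
  from the balance equations and are left out of them.
\<close>

lemma weighted_stationary_exists:
  fixes w :: "'a \<Rightarrow> 'a \<Rightarrow> real"
  assumes "finite V" "V \<noteq> {}" "\<And>u v. u \<in> V \<Longrightarrow> v \<in> V \<Longrightarrow> 0 \<le> w u v"
  shows "\<exists>\<phi>. (\<forall>u\<in>V. 0 \<le> \<phi> u) \<and> (\<exists>u\<in>V. 0 < \<phi> u) \<and>
           (\<forall>v\<in>V. (\<Sum>u\<in>V-{v}. \<phi> u * w u v) = \<phi> v * (\<Sum>u\<in>V-{v}. w v u))"
  using assms
proof (induction V arbitrary: w rule: finite_ne_induct)
  case (singleton x)
  show ?case by (rule exI[of _ "\<lambda>_. 1"]) simp
next
  case (insert x F)
  define W where "W = (\<Sum>v\<in>F. w x v)"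
  have nn: "0 \<le> w u v" if "u \<in> insert x F" "v \<in> insert x F" for u v
    using insert.prems that by blast
  have split: "(\<Sum>u\<in>insert x F - {v}. g u) = g x + (\<Sum>u\<in>F - {v}. g u)" if "v \<in> F" for v and g :: "'a \<Rightarrow> real"
  proof -
    have "insert x F - {v} = insert x (F - {v})" using that insert.hyps by auto
    thus ?thesis using insert.hyps by simp
  qed
  have rest: "insert x F - {x} = F" using insert.hyps by auto
  show ?case
  proof (cases "W = 0")
    case True
    have zero: "w x v = 0" if "v \<in> F" for v
      using True that insert.hyps nn unfolding W_def by (subst (asm) sum_nonneg_eq_0_iff) auto
    have nx: "u \<noteq> x" if "u \<in> F" for u using that insert.hyps by auto
    show ?thesis
      by (rule exI[of _ "\<lambda>u. if u = x then 1 else 0"])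
         (use zero True nx in \<open>auto simp: split rest W_def intro!: sum.neutral\<close>)
  next
    case False
    hence W: "W > 0" using nn unfolding W_def by (metis sum_nonneg insertCI order_less_le)
    \<comment> \<open>The walk with \<open>x\<close> eliminated: a visit to \<open>x\<close> becomes a jump to the place where \<open>x\<close> is left.\<close>
    define w' where "w' u v = w u v + w u x * w x v / W" for u v
    have "0 \<le> w' u v" if "u \<in> F" "v \<in> F" for u v
      unfolding w'_def using nn W that by (intro add_nonneg_nonneg divide_nonneg_nonneg mult_nonneg_nonneg) auto
    then obtain \<phi> where \<phi>: "\<And>u. u \<in> F \<Longrightarrow> 0 \<le> \<phi> u" "\<exists>u\<in>F. 0 < \<phi> u"
        "\<And>v. v \<in> F \<Longrightarrow> (\<Sum>u\<in>F-{v}. \<phi> u * w' u v) = \<phi> v * (\<Sum>u\<in>F-{v}. w' v u)"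
      using insert.IH[of w'] by blast
    define c where "c = (\<Sum>u\<in>F. \<phi> u * w u x) / W"
    define \<psi> where "\<psi> u = (if u = x then c else \<phi> u)" for u
    have \<psi>F: "\<psi> u = \<phi> u" if "u \<in> F" for u using that insert.hyps unfolding \<psi>_def by auto
    have \<psi>x: "\<psi> x = c" unfolding \<psi>_def by simp
    have c0: "0 \<le> c" unfolding c_def using W \<phi>(1) nn by (intro divide_nonneg_nonneg sum_nonneg mult_nonneg_nonneg) auto
    have cW: "c * W = (\<Sum>u\<in>F. \<phi> u * w u x)" unfolding c_def using W by simp
    have "(\<Sum>u\<in>insert x F-{v}. \<psi> u * w u v) = \<psi> v * (\<Sum>u\<in>insert x F-{v}. w v u)" if "v \<in> insert x F" for v
    proof (cases "v = x")
      case True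
      show ?thesis unfolding True rest \<psi>x W_def[symmetric] cW by (rule sum.cong) (auto simp: \<psi>F)
    next
      case False
      hence v: "v \<in> F" using that by simp
      have s1: "(\<Sum>u\<in>F-{v}. w x u) = W - w x v"
        unfolding W_def using insert.hyps v by (simp add: sum_diff1)
      have s2: "(\<Sum>u\<in>F-{v}. \<phi> u * w u x) = c * W - \<phi> v * w v x"
        unfolding cW using insert.hyps v by (simp add: sum_diff1)
      have "(\<Sum>u\<in>F-{v}. \<phi> u * w' u v) = (\<Sum>u\<in>F-{v}. \<phi> u * w u v) + (\<Sum>u\<in>F-{v}. \<phi> u * w u x) * w x v / W"
        unfolding w'_def by (simp add: algebra_simps sum.distrib sum_distrib_left sum_divide_distrib)
      also have "\<dots> = (\<Sum>u\<in>F-{v}. \<phi> u * w u v) + c * w x v - \<phi> v * w v x * w x v / W"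
        unfolding s2 using W by (simp add: field_simps)
      finally have L: "(\<Sum>u\<in>F-{v}. \<phi> u * w' u v) = \<dots>" .
      have "(\<Sum>u\<in>F-{v}. w' v u) = (\<Sum>u\<in>F-{v}. w v u) + w v x * (\<Sum>u\<in>F-{v}. w x u) / W"
        unfolding w'_def by (simp add: sum.distrib sum_distrib_left sum_divide_distrib)
      also have "\<dots> = (\<Sum>u\<in>F-{v}. w v u) + w v x - w v x * w x v / W"
        unfolding s1 using W by (simp add: field_simps)
      finally have R: "(\<Sum>u\<in>F-{v}. w' v u) = \<dots>" .
      have "(\<Sum>u\<in>F-{v}. \<psi> u * w u v) = (\<Sum>u\<in>F-{v}. \<phi> u * w u v)" by (rule sum.cong) (auto simp: \<psi>F)
      thus ?thesis using \<phi>(3)[OF v] unfolding split[OF v] \<psi>x \<psi>F[OF v] L R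
        by (simp add: algebra_simps)
    qed
    moreover have "\<forall>u\<in>insert x F. 0 \<le> \<psi> u" using \<psi>F \<psi>x c0 \<phi>(1) by auto
    moreover have "\<exists>u\<in>insert x F. 0 < \<psi> u" using \<psi>F \<phi>(2) by force
    ultimately show ?thesis by blast
  qed
qed

text \<open>
  With at least two vertices, strong connectivity gives every vertex an out-neighbour, so that the
  walk is well defined.
\<close>

locale walk_digraph =
  fixes D :: "'a pair_pre_digraph"
  assumes digraph: "pair_digraph D"
    and connected: "strongly_connected (with_proj D)"
    and two_vertices: "2 \<le> card (pverts D)"
begin

abbreviation "V \<equiv> pverts D"

abbreviation "N u \<equiv> parcs D `` {u}"

definition mean :: "('a \<Rightarrow> real) \<Rightarrow> 'a \<Rightarrow> real" where
  "mean h u = (\<Sum>v\<in>N u. h v) / card (N u)"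

lemma finite_V: "finite V"
  using digraph by (simp add: pair_digraph_def pair_fin_digraph_def pair_fin_digraph_axioms_def)

lemma N_subset: "N u \<subseteq> V"
  using digraph by (auto simp: pair_digraph_def pair_fin_digraph_def pair_wf_digraph_def)

lemma finite_N [simp]: "finite (N u)"
  using N_subset finite_V finite_subset by blast

lemma no_self_N: "u \<notin> N u"
  using digraph by (fastforce simp: pair_digraph_def pair_loopfree_digraph_def pair_loopfree_digraph_axioms_def)

text \<open>
  Strong connectivity in the form used throughout: a set that contains \<open>a\<close> but not \<open>b\<close> has an arc
  leaving it.
\<close>

lemma ex_arc_leaving:
  assumes "A \<subseteq> V" "a \<in> A" "b \<in> V" "b \<notin> A"
  obtains u v where "u \<in> A" "v \<in> N u" "v \<in> V" "v \<notin> A"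
proof -
  have "(a, b) \<in> rtrancl_on V (parcs D)"
    using connected assms by (auto simp: strongly_connected_def reachable_def)
  hence "b \<in> A \<or> (\<exists>u\<in>A. \<exists>v\<in>N u. v \<in> V \<and> v \<notin> A)"
    by (induction rule: rtrancl_on_induct) (use assms(2) in auto)
  thus ?thesis using assms(4) that by blast
qed

lemma N_nonempty:
  assumes "u \<in> V" shows "N u \<noteq> {}"
proof -
  have "\<not> V \<subseteq> {u}" using two_vertices card_mono[of "{u}" V] by auto
  then obtain b where "b \<in> V" "b \<noteq> u" by auto
  thus ?thesis using ex_arc_leaving[of "{u}" u b] assms by blast
qed

lemma card_N_pos: "u \<in> V \<Longrightarrow> 0 < card (N u)"
  using N_nonempty by (simp add: card_gt_0_iff)

lemma out_degree_eq: "out_degree (with_proj D) u = card (N u)"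
proof -
  have "out_arcs (with_proj D) u = Pair u ` N u" by (auto simp: out_arcs_def)
  thus ?thesis unfolding out_degree_def by (simp add: card_image inj_on_def)
qed

lemma rw_prob_eq: "rw_prob D u v = (if v \<in> N u then 1 / card (N u) else 0)"
  unfolding rw_prob_def out_degree_eq by simp

lemma sum_rw_prob: "(\<Sum>v\<in>V. rw_prob D u v * h v) = mean h u"
proof -
  have "(\<Sum>v\<in>V. rw_prob D u v * h v) = (\<Sum>v\<in>N u. h v / card (N u))"
    unfolding rw_prob_eq using finite_V N_subset by (intro sum.mono_neutral_cong_right) auto
  thus ?thesis by (simp add: mean_def sum_divide_distrib)
qed

lemma mean_const: "u \<in> V \<Longrightarrow> mean (\<lambda>_. c) u = c"
  using N_nonempty by (simp add: mean_def)

lemma mean_mono: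
  assumes "\<And>v. v \<in> V \<Longrightarrow> f v \<le> g v"
  shows "mean f u \<le> mean g u"
  unfolding mean_def using N_subset assms by (intro divide_right_mono sum_mono) auto

lemma rw_prob_nonneg: "0 \<le> rw_prob D u v"
  by (simp add: rw_prob_def)

text \<open>
  Mass flows along arcs, so the support of a non-negative stationary vector has no leaving arc.
\<close>

lemma stationary_pos:
  assumes nn: "\<And>u. u \<in> V \<Longrightarrow> 0 \<le> \<psi> u"
    and st: "\<And>v. v \<in> V \<Longrightarrow> (\<Sum>u\<in>V. \<psi> u * rw_prob D u v) = \<psi> v"
    and ex: "a \<in> V" "0 < \<psi> a" and "b \<in> V"
  shows "0 < \<psi> b"
proof (rule ccontr)
  assume "\<not> 0 < \<psi> b"
  then obtain u v where uv: "u \<in> {u\<in>V. 0 < \<psi> u}" "v \<in> N u" "v \<in> V" "v \<notin> {u\<in>V. 0 < \<psi> u}"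
    using ex_arc_leaving[of "{u\<in>V. 0 < \<psi> u}" a b] ex \<open>b \<in> V\<close> by auto
  have "0 < \<psi> u * rw_prob D u v"
    using uv card_N_pos by (simp add: rw_prob_eq)
  also have "\<dots> \<le> (\<Sum>u\<in>V. \<psi> u * rw_prob D u v)"
    using uv finite_V nn rw_prob_nonneg by (intro member_le_sum) auto
  finally show False using st uv by auto
qed

text \<open>
  Subtracting from one vector the largest multiple of the other that keeps the difference
  non-negative produces a non-negative stationary vector with a zero, which vanishes by
  \<open>stationary_pos\<close>. So the two vectors are proportional, and both have sum \<open>1\<close>.
\<close>

lemma perron_unique:
  assumes "is_perron_vector D \<phi>" "is_perron_vector D \<psi>" "v \<in> V"
  shows "\<phi> v = \<psi> v"
proof -
  have ne: "V \<noteq> {}" and fin: "finite V" using assms(3) finite_V by auto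
  have pos: "0 < \<psi> u" if "u \<in> V" for u using assms that by (simp add: is_perron_vector_def)
  \<comment> \<open>The largest \<open>c\<close> with \<open>c * \<psi> \<le> \<phi>\<close>; it is attained at \<open>m\<close>, where the difference vanishes.\<close>
  define c where "c = Min ((\<lambda>u. \<phi> u / \<psi> u) ` V)"
  have "c \<in> (\<lambda>u. \<phi> u / \<psi> u) ` V" unfolding c_def using ne fin by (intro Min_in) auto
  then obtain m where m: "m \<in> V" "c = \<phi> m / \<psi> m" by blast
  have c: "c * \<psi> u \<le> \<phi> u" if "u \<in> V" for u
  proof -
    have "c \<le> \<phi> u / \<psi> u" unfolding c_def using that fin by (intro Min_le) auto
    thus ?thesis using pos[OF that] by (simp add: field_simps)
  qed
  define \<chi> where "\<chi> u = \<phi> u - c * \<psi> u" for u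
  have st: "(\<Sum>u\<in>V. \<chi> u * rw_prob D u w) = \<chi> w" if "w \<in> V" for w
  proof -
    have "(\<Sum>u\<in>V. \<chi> u * rw_prob D u w)
        = (\<Sum>u\<in>V. \<phi> u * rw_prob D u w) - c * (\<Sum>u\<in>V. \<psi> u * rw_prob D u w)"
      unfolding \<chi>_def by (simp add: algebra_simps sum_subtractf sum_distrib_left)
    thus ?thesis using assms that by (simp add: is_perron_vector_def \<chi>_def)
  qed
  have "\<chi> m = 0" using m pos[OF m(1)] by (simp add: \<chi>_def)
  hence "\<not> 0 < \<chi> u" if "u \<in> V" for u
    using stationary_pos[of \<chi> u m] st c m(1) that by (auto simp: \<chi>_def)
  hence eq: "\<phi> u = c * \<psi> u" if "u \<in> V" for u using c that by (force simp: \<chi>_def)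
  have "1 = (\<Sum>u\<in>V. \<phi> u)" using assms by (simp add: is_perron_vector_def)
  also have "\<dots> = c * (\<Sum>u\<in>V. \<psi> u)" using eq by (simp add: sum_distrib_left)
  also have "\<dots> = c" using assms by (simp add: is_perron_vector_def)
  finally show ?thesis using eq assms(3) by simp
qed

lemma perron_exists: "\<exists>\<phi>. is_perron_vector D \<phi>"
proof -
  have ne: "V \<noteq> {}" using two_vertices by auto
  obtain \<psi> where \<psi>: "\<And>u. u \<in> V \<Longrightarrow> 0 \<le> \<psi> u" "\<exists>u\<in>V. 0 < \<psi> u"
      "\<And>v. v \<in> V \<Longrightarrow> (\<Sum>u\<in>V-{v}. \<psi> u * rw_prob D u v) = \<psi> v * (\<Sum>u\<in>V-{v}. rw_prob D v u)"
    using weighted_stationary_exists[OF finite_V ne, of "rw_prob D", OF rw_prob_nonneg] by blast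
  have diag: "rw_prob D v v = 0" for v using no_self_N by (simp add: rw_prob_eq)
  have row: "(\<Sum>u\<in>V. rw_prob D v u) = 1" if "v \<in> V" for v
    using sum_rw_prob[of v "\<lambda>_. 1"] mean_const that by simp
  have st: "(\<Sum>u\<in>V. \<psi> u * rw_prob D u v) = \<psi> v" if "v \<in> V" for v
    using \<psi>(3)[OF that] row[OF that] finite_V that diag by (simp add: sum_diff1)
  have pos: "0 < \<psi> u" if "u \<in> V" for u
    using stationary_pos[of \<psi>] \<psi>(1,2) st that by blast
  define S where "S = (\<Sum>u\<in>V. \<psi> u)"
  have "0 < S" unfolding S_def using finite_V ne pos by (intro sum_pos) auto
  have "(\<Sum>u\<in>V. \<psi> u / S * rw_prob D u v) = \<psi> v / S" if "v \<in> V" for v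
    using st[OF that] by (simp flip: sum_divide_distrib)
  moreover have "(\<Sum>u\<in>V. \<psi> u / S) = 1"
    using \<open>0 < S\<close> S_def by (simp flip: sum_divide_distrib)
  ultimately have "is_perron_vector D (\<lambda>u. \<psi> u / S)"
    using pos \<open>0 < S\<close> by (simp add: is_perron_vector_def)
  thus ?thesis by blast
qed

lemma perron_vector: "is_perron_vector D (perron_vector D)"
proof -
  obtain \<phi> where \<phi>: "is_perron_vector D \<phi>" using perron_exists by blast
  define \<psi> where "\<psi> u = (if u \<in> V then \<phi> u else 0)" for u
  have \<psi>: "is_perron_vector D \<psi>" using \<phi> by (simp add: is_perron_vector_def \<psi>_def cong: sum.cong)
  have "\<exists>!\<phi>. is_perron_vector D \<phi> \<and> (\<forall>u. u \<notin> V \<longrightarrow> \<phi> u = 0)"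
  proof (rule ex1I[of _ \<psi>], goal_cases)
    case 1
    show ?case using \<psi> by (simp add: \<psi>_def)
  next
    case (2 \<chi>)
    show ?case
    proof
      show "\<chi> v = \<psi> v" for v
        using 2 \<psi> perron_unique[of \<chi> \<psi> v] by (cases "v \<in> V") (auto simp: \<psi>_def)
    qed
  qed
  from theI'[OF this] show ?thesis unfolding perron_vector_def by blast
qed

lemma perron_vector_pos: "u \<in> V \<Longrightarrow> 0 < perron_vector D u"
  using perron_vector by (simp add: is_perron_vector_def)

section \<open>Escape probabilities\<close>

lemma perron_balance:
  "(\<Sum>u\<in>V. perron_vector D u * (mean h u - h u)) = 0"
proof -
  let ?\<phi> = "perron_vector D"
  have "(\<Sum>u\<in>V. ?\<phi> u * mean h u) = (\<Sum>u\<in>V. \<Sum>v\<in>V. ?\<phi> u * rw_prob D u v * h v)"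
    by (simp add: sum_rw_prob[symmetric] sum_distrib_left mult.assoc)
  also have "\<dots> = (\<Sum>v\<in>V. (\<Sum>u\<in>V. ?\<phi> u * rw_prob D u v) * h v)"
    by (subst sum.swap) (simp add: sum_distrib_right)
  also have "\<dots> = (\<Sum>v\<in>V. ?\<phi> v * h v)"
    using perron_vector by (intro sum.cong) (auto simp: is_perron_vector_def)
  finally show ?thesis by (simp add: right_diff_distrib sum_subtractf)
qed

text \<open>
  For a function that is harmonic away from two vertices, only these two survive in the balance
  identity. This turns a quotient of stationary probabilities into a quotient of local quantities.
\<close>

lemma perron_balance_two:
  assumes "s \<in> V" "t \<in> V" "s \<noteq> t"
    and "\<And>u. u \<in> V \<Longrightarrow> u \<noteq> s \<Longrightarrow> u \<noteq> t \<Longrightarrow> mean h u = h u"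
  shows "perron_vector D s * (mean h s - h s) = perron_vector D t * (h t - mean h t)"
proof -
  have "0 = (\<Sum>u\<in>{s,t}. perron_vector D u * (mean h u - h u))"
    unfolding perron_balance[of h, symmetric]
    using assms finite_V by (intro sum.mono_neutral_right) auto
  thus ?thesis using assms by (simp add: algebra_simps)
qed

text \<open>
  The probability of hitting \<open>t\<close> before \<open>s\<close>, obtained as the limit of the probabilities of doing so
  within \<open>k\<close> steps, which increase with \<open>k\<close> and are at most \<open>1\<close>.
\<close>

lemma escape_function_exists:
  assumes "s \<in> V" "t \<in> V" "s \<noteq> t"
  obtains h where "h s = 0" "h t = 1" "\<And>u. u \<in> V \<Longrightarrow> 0 \<le> h u" "\<And>u. u \<in> V \<Longrightarrow> h u \<le> 1"
    "\<And>u. u \<in> V \<Longrightarrow> u \<noteq> s \<Longrightarrow> u \<noteq> t \<Longrightarrow> mean h u = h u"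
proof -
  define step where "step f u = (if u = t then 1 else if u = s then 0 else mean f u)" for f u
  define f where "f k = (step ^^ k) (\<lambda>_. 0)" for k
  have f0: "f 0 u = 0" for u by (simp add: f_def)
  have fS: "f (Suc k) u = step (f k) u" for k u by (simp add: f_def)
  have step_mono: "step g u \<le> step g' u" if "\<And>v. v \<in> V \<Longrightarrow> g v \<le> g' v" for g g' u
    using mean_mono[of g g' u] that by (simp add: step_def)
  have nonneg: "0 \<le> f k u" for k u
  proof (induction k arbitrary: u)
    case (Suc k)
    have "0 \<le> mean (f k) u"
      unfolding mean_def using Suc.IH by (intro divide_nonneg_nonneg sum_nonneg) auto
    thus ?case by (simp add: fS step_def)
  qed (simp add: f0)
  have le1: "f k u \<le> 1" if "u \<in> V" for k u using that
  proof (induction k arbitrary: u)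
    case (Suc k)
    have "mean (f k) u \<le> mean (\<lambda>_. 1) u" using Suc.IH by (rule mean_mono)
    thus ?case using mean_const[OF Suc.prems, of 1] by (simp add: fS step_def)
  qed (simp add: f0)
  have inc: "f k u \<le> f (Suc k) u" for k u
  proof (induction k arbitrary: u)
    case (Suc k)
    show ?case unfolding fS[of "Suc k"] fS[of k u] by (rule step_mono) (rule Suc.IH)
  qed (simp add: f0 nonneg)
  have "\<exists>l. (\<lambda>k. f k u) \<longlonglongrightarrow> l" if "u \<in> V" for u
  proof -
    have "incseq (\<lambda>k. f k u)" using inc by (simp add: incseq_SucI)
    thus ?thesis using le1[OF that] by (meson incseq_convergent)
  qed
  then obtain h where h: "\<And>u. u \<in> V \<Longrightarrow> (\<lambda>k. f k u) \<longlonglongrightarrow> h u" by metis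
  have fix_h: "h u = step h u" if "u \<in> V" for u
  proof (rule LIMSEQ_unique)
    show "(\<lambda>k. f (Suc k) u) \<longlonglongrightarrow> h u" using h[OF that] by (rule LIMSEQ_Suc)
    have "(\<lambda>k. mean (f k) u) \<longlonglongrightarrow> mean h u"
      unfolding mean_def using h N_subset by (intro tendsto_divide tendsto_sum) (use card_N_pos[OF that] in auto)
    thus "(\<lambda>k. f (Suc k) u) \<longlonglongrightarrow> step h u" by (simp add: fS step_def)
  qed
  show ?thesis
  proof (rule that[of h])
    show "h s = 0" "h t = 1" using fix_h assms by (auto simp: step_def)
    show "mean h u = h u" if "u \<in> V" "u \<noteq> s" "u \<noteq> t" for u using fix_h that by (simp add: step_def)
    show "0 \<le> h u" if "u \<in> V" for u using h[OF that] nonneg by (meson LIMSEQ_le_const)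
    show "h u \<le> 1" if "u \<in> V" for u using h[OF that] le1[OF that] by (meson LIMSEQ_le_const2)
  qed
qed

end

section \<open>Deviations from a mean\<close>

text \<open>
  Let \<open>c\<close> be the mean of \<open>h\<close> over \<open>M\<close>. One member \<open>b\<close> above the mean is compensated by the others,
  and the elements of \<open>A\<close> can compensate at most the sum of their excesses below \<open>c\<close>. The slack in
  this inequality is written as a sum of non-negative terms, one for each element of \<open>A\<close>, so that the
  inequality and its equality case follow from the same identity.
\<close>

lemma deviation_slack:
  fixes h :: "'a \<Rightarrow> real"
  assumes "finite A" "M \<subseteq> A" "(\<Sum>u\<in>M. c - h u) = 0" "b \<in> M"
  shows "(\<Sum>u\<in>A. max 0 (c - h u) - (if u \<in> M - {b} then c - h u else 0))
       = (\<Sum>u\<in>A. max 0 (c - h u)) - (h b - c)"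
proof -
  have "(\<Sum>u\<in>A. if u \<in> M - {b} then c - h u else 0) = (\<Sum>u\<in>M - {b}. c - h u)"
    using assms by (intro sum.mono_neutral_cong_right) auto
  also have "\<dots> = h b - c"
    using assms finite_subset[OF assms(2,1)] by (simp add: sum_diff1)
  finally show ?thesis by (simp add: sum_subtractf)
qed

lemma deviation_le:
  fixes h :: "'a \<Rightarrow> real"
  assumes "finite A" "M \<subseteq> A" "(\<Sum>u\<in>M. c - h u) = 0" "b \<in> M"
  shows "h b - c \<le> (\<Sum>u\<in>A. max 0 (c - h u))"
  using deviation_slack[OF assms] sum_nonneg[of A "\<lambda>u. max 0 (c - h u) - (if u \<in> M - {b} then c - h u else 0)"]
  by auto

text \<open>
  If nothing is wasted, all elements below the mean are used and none but \<open>b\<close> lies above it.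
\<close>

lemma deviation_eqD:
  fixes h :: "'a \<Rightarrow> real"
  assumes "finite A" "M \<subseteq> A" "(\<Sum>u\<in>M. c - h u) = 0" "b \<in> M"
    and eq: "(\<Sum>u\<in>A. max 0 (c - h u)) \<le> h b - c"
  shows "u \<in> A \<Longrightarrow> h u < c \<Longrightarrow> u \<in> M"
    and "u \<in> M \<Longrightarrow> u \<noteq> b \<Longrightarrow> h u \<le> c"
proof -
  let ?g = "\<lambda>u. max 0 (c - h u) - (if u \<in> M - {b} then c - h u else 0)"
  have nn: "0 \<le> ?g u" for u by auto
  have "(\<Sum>u\<in>A. ?g u) \<le> 0" using deviation_slack[OF assms(1-4)] eq by linarith
  hence "(\<Sum>u\<in>A. ?g u) = 0" using sum_nonneg[of A ?g, OF nn] by linarith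
  hence "\<forall>u\<in>A. ?g u = 0" using sum_nonneg_eq_0_iff[of A ?g] assms(1) nn by blast
  hence z: "?g u = 0" if "u \<in> A" for u using that by blast
  show "u \<in> M" if "u \<in> A" "h u < c" using z[OF that(1)] that(2) by (auto split: if_splits)
  show "h u \<le> c" if "u \<in> M" "u \<noteq> b" using z[of u] that assms(2) by (auto split: if_splits)
qed

section \<open>Growth of the ordered values\<close>

text \<open>
  The maximum as \<open>2/3 * (1! + \<dots> + (n - 1)!)\<close>, the shape in which it arises as a sum of increments
  of the ordered values.
\<close>

definition max_ratio :: "nat \<Rightarrow> real" where
  "max_ratio n = 2 / 3 * (\<Sum>j<n-1. fact (j + 1))"

text \<open>
  Upper bounds for the increments \<open>y (j + 1) - y j\<close> when the first \<open>z + 1\<close> values are zero. With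
  \<open>S j = (\<Sum>i<j. y j - y i)\<close> the hypotheses below give \<open>S (j + 1) \<le> (j + 2) * S j\<close> and
  \<open>S (z + 1) \<le> (z + 1)\<^sup>2 * e\<close>, and the last line of the definition bounds \<open>S j\<close>,
  which in turn bounds the increment.
\<close>

definition increment_bound :: "nat \<Rightarrow> real \<Rightarrow> nat \<Rightarrow> real" where
  "increment_bound z e j = (if j < z then 0 else if j = z then real (z + 1) * e
     else real ((z + 1)^2) / fact (z + 2) * fact (j + 1) * e)"

text \<open>
  The sequence \<open>y\<close> stands for the sorted values of an escape function, \<open>z\<close> for the last position with
  value zero, and \<open>e\<close> for the escape probability.
\<close>

context
  fixes y :: "nat \<Rightarrow> real" and n z :: nat and e :: real
  assumes n3: "3 \<le> n" and zn: "z + 1 < n" and epos: "0 < e"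
    and zero: "\<And>j. j \<le> z \<Longrightarrow> y j = 0"
    and first: "y (z + 1) \<le> (z + 1) * e"
    and step: "\<And>j. z < j \<Longrightarrow> j + 1 < n \<Longrightarrow> y (j + 1) - y j \<le> (\<Sum>i<j. y j - y i)"
begin

lemma sum_deviation_Suc:
  "(\<Sum>i<Suc j. y (Suc j) - y i) = (\<Sum>i<j. y j - y i) + (j + 1) * (y (Suc j) - y j)"
  by (simp add: sum_subtractf algebra_simps)

lemma sum_deviation_le:
  assumes "z < j" "j < n"
  shows "(\<Sum>i<j. y j - y i) \<le> (z + 1)^2 / fact (z + 2) * fact (j + 1) * e"
  using assms
proof (induction j rule: less_induct)
  case (less j)
  then obtain k where k: "j = Suc k" "z \<le> k" by (cases j) auto
  show ?case
  proof (cases "k = z")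
    case True
    have "(\<Sum>i<j. y j - y i) = (z + 1) * y (z + 1)"
      unfolding k True using zero by (simp add: sum_subtractf)
    also have "\<dots> \<le> (z + 1) * ((z + 1) * e)" using first by (intro mult_left_mono) auto
    also have "\<dots> = (z + 1)^2 / fact (z + 2) * fact (j + 1) * e"
      unfolding k True by (simp add: power2_eq_square del: fact_Suc) (simp add: algebra_simps)
    finally show ?thesis .
  next
    case False
    hence zk: "z < k" "k + 1 < n" using k less.prems by auto
    let ?S = "\<Sum>i<k. y k - y i"
    have "(\<Sum>i<j. y j - y i) = ?S + (k + 1) * (y (k + 1) - y k)"
      unfolding k sum_deviation_Suc by simp
    also have "\<dots> \<le> ?S + (k + 1) * ?S"
      using step[OF zk] by (intro add_mono mult_left_mono) auto
    also have "\<dots> = (real k + 2) * ?S" by (simp add: algebra_simps)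
    also have "\<dots> \<le> (real k + 2) * ((z + 1)^2 / fact (z + 2) * fact (k + 1) * e)"
      using less.IH[of k] zk k by (intro mult_left_mono) auto
    also have "\<dots> = (z + 1)^2 / fact (z + 2) * ((real k + 2) * fact (k + 1)) * e"
      by (simp only: mult_ac)
    also have "(real k + 2) * fact (k + 1) = fact (j + 1)"
      unfolding k by (simp add: algebra_simps)
    finally show ?thesis .
  qed
qed

lemma increment_le:
  assumes "j < n - 1"
  shows "y (Suc j) - y j \<le> increment_bound z e j"
proof -
  consider "j < z" | "j = z" | "z < j" by linarith
  thus ?thesis
  proof cases
    case 1 thus ?thesis using zero by (simp add: increment_bound_def)
  next
    case 2 thus ?thesis using zero first by (simp add: increment_bound_def)
  next
    case 3
    have "j + 1 < n" "j < n" using assms by auto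
    thus ?thesis using step[of j] sum_deviation_le[of j] 3 by (simp add: increment_bound_def del: fact_Suc)
  qed
qed

lemma sum_increments: "y (n - 1) = (\<Sum>j<n-1. y (Suc j) - y j)"
  using zero by (subst sum_lessThan_telescope) simp

text \<open>
  Termwise comparison with \<open>2/3 * fact (j + 1)\<close> for \<open>z \<ge> 2\<close>: the first estimate handles the positions
  after \<open>z\<close>, the second, strict one the position \<open>z\<close> itself.
\<close>

lemma coefficient_le:
  assumes "2 \<le> z"
  shows "(z + 1)^2 / fact (z + 2) \<le> (2 / 3 :: real)" and "real (z + 1) < 2 / 3 * fact (z + 1)"
proof -
  have f2: "2 \<le> (fact z :: real)" using fact_mono[OF assms, where 'a = real] by (simp add: numeral_2_eq_2)
  have "real (z + 1) * (3 / 2) < real (z + 1) * fact z"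
    using f2 by (intro mult_strict_left_mono) auto
  thus "real (z + 1) < 2 / 3 * fact (z + 1)" by simp
  have "3 * real ((z + 1)^2) \<le> 2 * (real (z + 2) * (real (z + 1) * 2))"
    by (simp add: power2_eq_square algebra_simps)
  also have "\<dots> \<le> 2 * (real (z + 2) * (real (z + 1) * fact z))"
    using f2 by (intro mult_left_mono) auto
  also have "\<dots> = 2 * fact (z + 2)" by (simp add: algebra_simps)
  finally show "(z + 1)^2 / fact (z + 2) \<le> (2 / 3 :: real)"
    by (simp add: divide_le_eq del: fact_Suc)
qed

text \<open>
  The case \<open>z = 1\<close> is optimal: the two initial increments \<open>0\<close> and \<open>2 * e\<close> match
  \<open>2/3 * (1! + 2!) * e\<close>, and all later bounds agree term by term.
\<close>

lemma sum_increment_bounds_z1: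
  assumes "z = 1"
  shows "(\<Sum>j<n-1. increment_bound z e j) = e * max_ratio n"
proof -
  define m where "m = n - 3"
  have m: "n - 1 = Suc (Suc m)" using n3 by (simp add: m_def)
  have "(\<Sum>j<m. increment_bound z e (Suc (Suc j))) = (\<Sum>j<m. e * (2/3 * fact (Suc (Suc j) + 1)))"
    by (rule sum.cong) (simp_all add: increment_bound_def assms field_simps)
  thus ?thesis unfolding max_ratio_def m sum.lessThan_Suc_shift
    by (simp add: increment_bound_def assms sum_distrib_left algebra_simps del: fact_Suc)
       (simp add: fact_numeral)
qed

text \<open>
  For \<open>z = 0\<close> the deficit is an explicit sum, which is empty exactly for \<open>n = 3\<close>. This is why three
  vertices admit a second optimal position of \<open>s\<close>.
\<close>

lemma sum_increment_bounds_z0: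
  assumes "z = 0"
  shows "(\<Sum>j<n-1. increment_bound z e j) = e * max_ratio n - e / 6 * (\<Sum>j<n-3. fact (j + 3))"
proof -
  define m where "m = n - 3"
  have m: "n - 1 = Suc (Suc m)" "n - 3 = m" using n3 by (simp_all add: m_def)
  have a: "(\<Sum>j<m. increment_bound z e (Suc (Suc j))) = e / 2 * (\<Sum>j<m. fact (j + 3))"
    unfolding sum_distrib_left
    by (rule sum.cong) (simp_all add: increment_bound_def assms eval_nat_numeral)
  have b: "max_ratio n = 2 + 2 / 3 * (\<Sum>j<m. fact (j + 3))"
    unfolding max_ratio_def m sum.lessThan_Suc_shift
    by (simp add: eval_nat_numeral distrib_left)
  have c: "increment_bound z e 0 = e" "increment_bound z e (Suc 0) = e" by (simp_all add: increment_bound_def assms fact_numeral)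
  show ?thesis unfolding m(1) sum.lessThan_Suc_shift a b c m(2) by (simp add: algebra_simps)
qed

lemma sum_increment_bounds_less:
  assumes "2 \<le> z"
  shows "(\<Sum>j<n-1. increment_bound z e j) < e * max_ratio n"
proof -
  have "(\<Sum>j<n-1. increment_bound z e j) < (\<Sum>j<n-1. e * (2 / 3 * fact (j + 1)))"
  proof (rule sum_strict_mono_ex1)
    show "\<forall>j\<in>{..<n-1}. increment_bound z e j \<le> e * (2 / 3 * fact (j + 1))"
    proof
      fix j
      have "(z + 1)^2 / fact (z + 2) * (fact (j + 1) * e) \<le> 2 / 3 * (fact (j + 1) * e)"
        using coefficient_le(1)[OF assms] epos by (intro mult_right_mono) auto
      thus "increment_bound z e j \<le> e * (2 / 3 * fact (j + 1))"
        using coefficient_le(2)[OF assms] epos unfolding increment_bound_def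
        by (auto simp: mult_ac simp del: fact_Suc)
    qed
    show "\<exists>j\<in>{..<n-1}. increment_bound z e j < e * (2 / 3 * fact (j + 1))"
      using coefficient_le(2)[OF assms] epos zn
      by (intro bexI[of _ z]) (auto simp: increment_bound_def mult_ac simp del: fact_Suc)
  qed simp
  thus ?thesis by (simp add: max_ratio_def sum_distrib_left)
qed

lemma sum_increment_bounds_le: "(\<Sum>j<n-1. increment_bound z e j) \<le> e * max_ratio n"
proof -
  consider "z = 0" | "z = 1" | "2 \<le> z" by linarith
  thus ?thesis
  proof cases
    case 1
    thus ?thesis using sum_increment_bounds_z0 epos by (simp add: sum_nonneg)
  qed (use sum_increment_bounds_z1 sum_increment_bounds_less in auto)
qed

lemma last_le: "y (n - 1) \<le> e * max_ratio n"
proof -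
  have "y (n - 1) \<le> (\<Sum>j<n-1. increment_bound z e j)"
    unfolding sum_increments using increment_le by (intro sum_mono) auto
  thus ?thesis using sum_increment_bounds_le by simp
qed

text \<open>
  Equality of the totals forces each increment to equal its bound. For \<open>j > z\<close> this bound arises from
  the local inequality followed by \<open>sum_deviation_le\<close>, so both are equalities.
\<close>

lemma last_eqD:
  assumes eq: "y (n - 1) = e * max_ratio n"
  shows "z = 1 \<or> z = 0 \<and> n = 3" and "y (z + 1) = (z + 1) * e"
    and "\<And>j. z < j \<Longrightarrow> j + 1 < n \<Longrightarrow> y (j + 1) - y j = (\<Sum>i<j. y j - y i)"
proof -
  have le: "(\<Sum>j<n-1. y (Suc j) - y j) \<le> (\<Sum>j<n-1. increment_bound z e j)"
    using increment_le by (intro sum_mono) auto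
  have sum_eq: "(\<Sum>j<n-1. y (Suc j) - y j) = (\<Sum>j<n-1. increment_bound z e j)"
    using le sum_increment_bounds_le eq unfolding sum_increments by linarith
  have B: "y (Suc j) - y j = increment_bound z e j" if "j < n - 1" for j
    using sum_mono_inv[OF sum_eq, of j] increment_le that by auto
  consider "z = 0" | "z = 1" | "2 \<le> z" by linarith
  thus "z = 1 \<or> z = 0 \<and> n = 3"
  proof cases
    case 1
    have "e / 6 * (\<Sum>j<n-3. fact (j + 3)) = 0"
      using sum_increment_bounds_z0[OF 1] sum_eq eq unfolding sum_increments by linarith
    hence "(\<Sum>j<n-3. fact (j + 3)) = (0::real)" using epos by simp
    hence "\<forall>j<n-3. fact (j + 3) = (0::real)" by (subst (asm) sum_nonneg_eq_0_iff) auto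
    hence "n - 3 = 0" by (metis fact_nonzero gr0I)
    thus ?thesis using 1 n3 by simp
  next
    case 3
    thus ?thesis using sum_increment_bounds_less sum_eq eq unfolding sum_increments by simp
  qed simp
  show "y (z + 1) = (z + 1) * e" using B[of z] zn zero by (simp add: increment_bound_def)
  show "y (j + 1) - y j = (\<Sum>i<j. y j - y i)" if "z < j" "j + 1 < n" for j
    using B[of j] sum_deviation_le[of j] step[OF that] that by (simp add: increment_bound_def del: fact_Suc)
qed

end

section \<open>Levels of an escape function\<close>

text \<open>
  The zeros of \<open>h\<close> come first in a sorted list, in any order among themselves, so \<open>s\<close> can be moved to
  the last position \<open>z\<close> of this block.
\<close>

lemma sorted_enumeration:
  fixes h :: "'a \<Rightarrow> real"
  assumes "finite V" "s \<in> V" "h s = 0" "\<And>u. u \<in> V \<Longrightarrow> 0 \<le> h u"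
  obtains w z where "bij_betw w {..<card V} V" "w z = s" "z < card V"
    "\<And>i j. i \<le> j \<Longrightarrow> j < card V \<Longrightarrow> h (w i) \<le> h (w j)"
    "\<And>j. j < card V \<Longrightarrow> h (w j) = 0 \<longleftrightarrow> j \<le> z"
proof -
  obtain xs where xs: "set xs = V" "distinct xs" using finite_distinct_list[OF assms(1)] by blast
  define ys where "ys = sort_key h xs"
  define n where "n = card V"
  have ys: "set ys = V" "distinct ys" "length ys = n"
    unfolding ys_def n_def using xs distinct_card[of xs] by auto
  have so: "sorted (map h ys)" unfolding ys_def by simp
  define v where "v i = ys ! i" for i
  have bij: "bij_betw v {..<n} V" unfolding v_def using ys bij_betw_nth[of ys] by simp
  have mono: "h (v i) \<le> h (v j)" if "i \<le> j" "j < n" for i j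
    using sorted_nth_mono[OF so that(1)] that ys(3) by (simp add: v_def)
  obtain k where k: "k < n" "v k = s" using bij assms(2) by (metis bij_betw_iff_bijections lessThan_iff)
  define Z where "Z = {j. j < n \<and> h (v j) = 0}"
  define z where "z = Max Z"
  have Z: "finite Z" "k \<in> Z" unfolding Z_def using k assms(3) by auto
  have zZ: "z \<in> Z" unfolding z_def using Z by (intro Max_in) auto
  have Zle: "j \<le> z" if "j \<in> Z" for j unfolding z_def using Z that by simp
  have zero: "h (v j) = 0 \<longleftrightarrow> j \<le> z" if "j < n" for j
  proof
    assume "h (v j) = 0" thus "j \<le> z" using Zle that by (simp add: Z_def)
  next
    assume "j \<le> z"
    hence "h (v j) \<le> 0" using mono[of j z] zZ by (simp add: Z_def)
    thus "h (v j) = 0" using assms(4)[of "v j"] bij that by (auto simp: bij_betw_def)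
  qed
  \<comment> \<open>Positions \<open>k\<close> and \<open>z\<close> both carry the value zero, so the exchange keeps the list sorted.\<close>
  define w where "w = v \<circ> Transposition.transpose z k"
  have hw: "h (w j) = h (v j)" for j
    using zZ Z(2) by (auto simp: w_def Z_def Transposition.transpose_def)
  have "bij_betw (Transposition.transpose z k) {..<n} {..<n}"
    using zZ k by (simp add: Z_def bij_betw_transpose_iff)
  hence "bij_betw w {..<n} V" unfolding w_def using bij by (rule bij_betw_trans)
  moreover have "w z = s" by (simp add: w_def k)
  ultimately show ?thesis using that[of w z] mono zero zZ unfolding hw n_def[symmetric] by (simp add: Z_def)
qed

text \<open>
  The shape of the extremal digraphs without reference to names of vertices: \<open>w j\<close> plays the role of
  \<open>v\<^sub>j\<^sub>+\<^sub>1\<close>.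
\<close>

definition (in walk_digraph) staircase :: "(nat \<Rightarrow> 'a) \<Rightarrow> bool" where
  "staircase w \<longleftrightarrow> bij_betw w {..<card V} V \<and> N (w 0) = {w 1} \<and>
     (\<forall>j. 1 \<le> j \<longrightarrow> j + 1 < card V \<longrightarrow> N (w j) = insert (w (j + 1)) (w ` {..<j})) \<and>
     N (w (card V - 1)) \<subseteq> {w 0, w 1}"

context walk_digraph
begin

lemma mean_eq_0D:
  assumes "\<And>v. v \<in> V \<Longrightarrow> 0 \<le> h v" "u \<in> V" "mean h u = 0" "v \<in> N u"
  shows "h v = 0"
proof -
  have "(\<Sum>v\<in>N u. h v) = 0" using assms(2,3) N_nonempty by (simp add: mean_def)
  thus ?thesis using assms(1,4) N_subset by (subst (asm) sum_nonneg_eq_0_iff) auto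
qed

lemma sum_mean_deviation:
  assumes "u \<in> V" shows "(\<Sum>v\<in>N u. mean h u - h v) = 0"
  using N_nonempty[OF assms] by (simp add: sum_subtractf mean_def)

lemma ex_neighbour_above:
  assumes "u \<in> V" "v \<in> N u" "h v < mean h u"
  shows "\<exists>b\<in>N u. mean h u < h b"
proof (rule ccontr)
  assume "\<not> ?thesis"
  hence "h b \<le> mean h u" if "b \<in> N u" for b using that not_less by blast
  hence "0 < (\<Sum>v\<in>N u. mean h u - h v)" using assms by (intro sum_pos2[of _ v]) auto
  thus False using sum_mean_deviation[OF assms(1)] by simp
qed

text \<open>
  In this context \<open>h\<close> is the escape function from \<open>s\<close> to \<open>t\<close> and \<open>w\<close> lists the vertices by increasing
  \<open>h\<close>.
\<close>

context
  fixes s t :: 'a and h :: "'a \<Rightarrow> real" and w :: "nat \<Rightarrow> 'a" and z n :: nat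
  defines "n \<equiv> card V"
  assumes n3: "3 \<le> n" and sV: "s \<in> V" and tV: "t \<in> V"
    and hs: "h s = 0" and ht: "h t = 1"
    and h0: "\<And>u. u \<in> V \<Longrightarrow> 0 \<le> h u" and h1: "\<And>u. u \<in> V \<Longrightarrow> h u \<le> 1"
    and harm: "\<And>u. u \<in> V \<Longrightarrow> u \<noteq> s \<Longrightarrow> u \<noteq> t \<Longrightarrow> mean h u = h u"
    and bij: "bij_betw w {..<n} V" and wz: "w z = s" and zn: "z < n"
    and mono: "\<And>i j. i \<le> j \<Longrightarrow> j < n \<Longrightarrow> h (w i) \<le> h (w j)"
    and zero: "\<And>j. j < n \<Longrightarrow> h (w j) = 0 \<longleftrightarrow> j \<le> z"
begin

lemma w_in: "j < n \<Longrightarrow> w j \<in> V"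
  using bij by (auto simp: bij_betw_def)

lemma index:
  assumes "u \<in> V" obtains j where "j < n" "u = w j"
  using bij assms by (auto simp: bij_betw_def)

lemma w_eq_iff: "i < n \<Longrightarrow> j < n \<Longrightarrow> w i = w j \<longleftrightarrow> i = j"
  using bij by (auto simp: bij_betw_def inj_on_def)

lemma h_last: "h (w (n - 1)) = 1"
proof -
  obtain k where "k < n" "t = w k" using index[OF tV] .
  hence "1 \<le> h (w (n - 1))" using mono[of k "n - 1"] ht by simp
  thus ?thesis using h1[OF w_in] zn by (simp add: order_antisym)
qed

lemma z_less: "z + 1 < n"
proof -
  have "\<not> n - 1 \<le> z" using zero[of "n - 1"] h_last n3 by simp
  thus ?thesis by simp
qed

lemma h_ge_if_gt:
  assumes "u \<in> V" "h (w j) < h u" "j + 1 < n"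
  shows "h (w (j + 1)) \<le> h u"
proof -
  obtain k where k: "k < n" "u = w k" using index[OF assms(1)] .
  have "\<not> k \<le> j" using mono[of k j] assms k by auto
  thus ?thesis using mono[of "j + 1" k] k by simp
qed

text \<open>
  Some arc leaves the zero set of \<open>h\<close>. Its tail cannot be harmonic, since then all out-neighbours
  would be zeros too, so it is \<open>s\<close>.
\<close>

lemma ex_exit_from_s:
  obtains v where "v \<in> N s" "h (w (z + 1)) \<le> h v"
proof -
  have "t \<notin> {u \<in> V. h u = 0}" using ht by simp
  then obtain u v where uv: "u \<in> {u \<in> V. h u = 0}" "v \<in> N u" "v \<in> V" "v \<notin> {u \<in> V. h u = 0}"
    using ex_arc_leaving[of "{u \<in> V. h u = 0}" s t] sV tV hs by auto
  have "u = s"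
  proof (rule ccontr)
    assume "u \<noteq> s"
    moreover have "u \<noteq> t" using uv(1) ht by auto
    ultimately have "mean h u = 0" using harm[of u] uv by auto
    thus False using mean_eq_0D[of h u v] h0 uv by auto
  qed
  moreover have "h (w (z + 1)) \<le> h v"
    using h_ge_if_gt[of v z] wz hs h0[of v] uv z_less by force
  ultimately show ?thesis using that uv by blast
qed

lemma escape_pos: "0 < mean h s"
proof -
  obtain v where v: "v \<in> N s" "h (w (z + 1)) \<le> h v" using ex_exit_from_s .
  have "h (w (z + 1)) \<noteq> 0" using zero[of "z + 1"] z_less by simp
  hence "0 < h v" using v h0[OF w_in[of "z + 1"]] z_less by simp
  hence "mean h s \<noteq> 0" using mean_eq_0D[of h s v] h0 sV v(1) by auto
  moreover have "0 \<le> mean h s" using mean_mono[of "\<lambda>_. 0" h s] mean_const[OF sV, of 0] h0 by simp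
  ultimately show ?thesis by simp
qed

lemma sum_excess: "(\<Sum>u\<in>V. max 0 (c - h u)) = (\<Sum>i<n. max 0 (c - h (w i)))"
  using sum.reindex_bij_betw[OF bij, of "\<lambda>u. max 0 (c - h u)"] by simp

text \<open>
  The total amount by which vertices lie below level \<open>j\<close>: the right-hand side of the local inequality.
\<close>

lemma sum_excess_level:
  assumes "j < n"
  shows "(\<Sum>u\<in>V. max 0 (h (w j) - h u)) = (\<Sum>i<j. h (w j) - h (w i))"
  unfolding sum_excess
proof (rule sum.mono_neutral_cong_right)
  show "\<forall>i\<in>{..<n} - {..<j}. max 0 (h (w j) - h (w i)) = 0" using mono[of j] by auto
  show "max 0 (h (w j) - h (w i)) = h (w j) - h (w i)" if "i \<in> {..<j}" for i
    using mono[of i j] that assms by auto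
qed (use assms in auto)

text \<open>
  Below the first positive level only zeros can compensate, and \<open>s\<close> is not its own out-neighbour. This
  leaves \<open>z\<close> vertices.
\<close>

lemma sum_excess_s:
  fixes c :: real
  assumes "c \<le> h (w (z + 1))" "0 \<le> c"
  shows "(\<Sum>u\<in>V - {s}. max 0 (c - h u)) = z * c"
proof -
  have "(\<Sum>u\<in>V. max 0 (c - h u)) = (\<Sum>i<z + 1. c)"
    unfolding sum_excess
  proof (rule sum.mono_neutral_cong_right)
    show "\<forall>i\<in>{..<n} - {..<z+1}. max 0 (c - h (w i)) = 0"
    proof
      fix i assume "i \<in> {..<n} - {..<z+1}"
      thus "max 0 (c - h (w i)) = 0" using mono[of "z + 1" i] assms by auto
    qed
    show "max 0 (c - h (w i)) = c" if "i \<in> {..<z + 1}" for i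
      using zero[of i] that assms z_less by auto
  qed (use z_less in auto)
  thus ?thesis using sV finite_V hs assms(2) by (simp add: sum_diff1 algebra_simps)
qed

text \<open>
  The deviation argument applied at \<open>s\<close>, where the mean of the out-neighbours is the escape probability
  instead of \<open>h s = 0\<close>.
\<close>

lemma first_level_le: "h (w (z + 1)) \<le> (z + 1) * mean h s"
proof (cases "mean h s \<le> h (w (z + 1))")
  case True
  obtain v where v: "v \<in> N s" "h (w (z + 1)) \<le> h v" using ex_exit_from_s .
  have "N s \<subseteq> V - {s}" using N_subset no_self_N by auto
  hence "h v - mean h s \<le> z * mean h s"
    using deviation_le[of "V - {s}" "N s" "mean h s" h v] finite_V sum_mean_deviation[OF sV] v(1)
      sum_excess_s[OF True] escape_pos by simp
  thus ?thesis using v(2) by (simp add: algebra_simps)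
next
  case False
  have "1 * mean h s \<le> (z + 1) * mean h s" using escape_pos by (intro mult_right_mono) auto
  thus ?thesis using False by simp
qed

text \<open>
  If there is a gap above level \<open>j\<close>, the set of vertices with this value does not contain \<open>t\<close>, hence has
  a leaving arc. The arc may go down, but then the mean value property yields an arc from the same tail
  that goes up. The tail need not be \<open>w j\<close> when values are repeated, which does not matter
  because only its value enters.
\<close>

lemma ex_exit_from_level:
  assumes "z < j" "j + 1 < n" "h (w j) < h (w (j + 1))"
  obtains a b where "a \<in> V" "h a = h (w j)" "mean h a = h a" "b \<in> N a" "h (w (j + 1)) \<le> h b"
proof -
  let ?A = "{u \<in> V. h u = h (w j)}"
  have j: "h (w j) \<noteq> 0" using zero[of j] assms by simp
  have "h (w (j + 1)) \<le> 1" using h1 w_in assms by simp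
  hence j1: "h (w j) \<noteq> 1" using assms(3) by simp
  have "\<exists>u v. u \<in> ?A \<and> v \<in> N u \<and> v \<in> V \<and> v \<notin> ?A"
    using ex_arc_leaving[of ?A "w j" t] w_in[of j] assms tV ht j1 by (metis (mono_tags, lifting) mem_Collect_eq subsetI add_lessD1)
  then obtain a v where av: "a \<in> ?A" "v \<in> N a" "v \<in> V" "v \<notin> ?A" by blast
  have "a \<noteq> s" "a \<noteq> t" using av(1) j j1 hs ht by auto
  hence ma: "mean h a = h a" using harm[of a] av(1) by auto
  have "\<exists>b\<in>N a. h a < h b"
  proof (cases "h v < h a")
    case True
    thus ?thesis using ex_neighbour_above[of a v h] av ma by auto
  next
    case False
    thus ?thesis using av by force
  qed
  then obtain b where b: "b \<in> N a" "h a < h b" by blast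
  hence "h (w (j + 1)) \<le> h b" using h_ge_if_gt[of b j] av(1) assms N_subset[of a] by auto
  thus ?thesis using that[of a b] av(1) ma b by auto
qed

text \<open>
  The upward arc must be compensated by lower vertices, each of which can be used once.
\<close>

lemma level_step:
  assumes "z < j" "j + 1 < n"
  shows "h (w (j + 1)) - h (w j) \<le> (\<Sum>i<j. h (w j) - h (w i))"
proof (cases "h (w j) < h (w (j + 1))")
  case True
  obtain a b where ab: "a \<in> V" "h a = h (w j)" "mean h a = h a" "b \<in> N a" "h (w (j + 1)) \<le> h b"
    using ex_exit_from_level[OF assms True] .
  have "h b - h (w j) \<le> (\<Sum>u\<in>V. max 0 (h (w j) - h u))"
    using deviation_le[of V "N a" "h a" h b] finite_V N_subset sum_mean_deviation[OF ab(1), of h] ab by simp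
  thus ?thesis using sum_excess_level[of j] ab assms by simp
next
  case False
  have "0 \<le> (\<Sum>i<j. h (w j) - h (w i))" using mono assms by (intro sum_nonneg) auto
  thus ?thesis using False by simp
qed

section \<open>The bound and the case of equality\<close>

lemma escape_lower_bound: "1 \<le> mean h s * max_ratio n"
  using last_le[of n z "mean h s" "\<lambda>j. h (w j)", OF n3 z_less escape_pos _ first_level_le level_step]
    zero z_less h_last by simp

text \<open>
  Equality in the bound gives equality in the local inequality at each level, and \<open>deviation_eqD\<close>
  then determines the out-neighbours. Strictly increasing values identify the vertices involved.
\<close>

lemma staircase_if_minimal_escape:
  assumes eq: "mean h s * max_ratio n = 1" and mt: "mean h t = 0"
  shows "staircase w"
proof -
  have ex: "z = 1 \<or> z = 0 \<and> n = 3" "h (w (z + 1)) = (z + 1) * mean h s"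
      "\<And>j. z < j \<Longrightarrow> j + 1 < n \<Longrightarrow> h (w (j + 1)) - h (w j) = (\<Sum>i<j. h (w j) - h (w i))"
    using last_eqD[of n z "mean h s" "\<lambda>j. h (w j)", OF n3 z_less escape_pos _ first_level_le level_step]
      zero z_less h_last eq by auto
  have strict_Suc: "h (w j) < h (w (Suc j))" if "z \<le> j" "Suc j < n" for j
  proof (cases "j = z")
    case True
    thus ?thesis using hs wz zero[of "z + 1"] h0[OF w_in[of "z + 1"]] z_less by simp
  next
    case False
    hence j: "z < j" using that by simp
    have "0 < (\<Sum>i<j. h (w j) - h (w i))"
    proof (rule sum_pos2[of _ z])
      show "0 < h (w j) - h (w z)"
        using hs wz zero[of j] h0[OF w_in[of j]] that j by simp
      show "0 \<le> h (w j) - h (w i)" if "i \<in> {..<j}" for i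
        using mono[of i j] that \<open>Suc j < n\<close> by simp
    qed (use j in auto)
    thus ?thesis using ex(3)[OF j] that by simp
  qed
  have strict: "h (w i) < h (w j)" if "z < j" "i < j" "j < n" for i j
  proof -
    have "h (w i) \<le> h (w (j - 1))" using mono[of i "j - 1"] that by simp
    also have "\<dots> < h (w j)" using strict_Suc[of "j - 1"] that by simp
    finally show ?thesis .
  qed
  have le_iff: "h (w i) \<le> h (w j) \<longleftrightarrow> i \<le> j" and less_iff: "h (w i) < h (w j) \<longleftrightarrow> i < j"
    and eq_iff: "h (w i) = h (w j) \<longleftrightarrow> i = j" if "z < j" "i < n" "j < n" for i j
    using strict[of i j] strict[of j i] that by (force simp: not_le[symmetric] not_less_iff_gr_or_eq)+
  have inner: "N (w j) = insert (w (j + 1)) (w ` {..<j})" if j: "z < j" "j + 1 < n" for j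
  proof -
    have "h (w j) < h (w (j + 1))" using strict_Suc[of j] j by simp
    then obtain a b where ab: "a \<in> V" "h a = h (w j)" "mean h a = h a" "b \<in> N a" "h (w (j + 1)) \<le> h b"
      using ex_exit_from_level[OF j] by blast
    obtain i where i: "i < n" "a = w i" using index[OF ab(1)] .
    have a: "a = w j" using eq_iff[of j i] i ab(2) j by simp
    have S: "(\<Sum>u\<in>V. max 0 (h a - h u)) = h (w (j + 1)) - h a"
      using sum_excess_level[of j] ex(3)[OF j] j a by simp
    have sm: "(\<Sum>u\<in>N a. h a - h u) = 0" using sum_mean_deviation[OF ab(1), of h] ab(3) by simp
    note dev = finite_V N_subset sm ab(4)
    have "h b = h (w (j + 1))" using deviation_le[OF dev] S ab(5) by simp
    moreover obtain k where k: "k < n" "b = w k" using index ab(4) N_subset by blast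
    ultimately have b: "b = w (j + 1)" using eq_iff[of "j + 1" k] j by simp
    have le: "(\<Sum>u\<in>V. max 0 (h a - h u)) \<le> h b - h a" unfolding S b by simp
    show ?thesis
    proof (intro subset_antisym subsetI)
      fix u assume u: "u \<in> N (w j)"
      obtain k where k: "k < n" "u = w k" using index u N_subset by blast
      show "u \<in> insert (w (j + 1)) (w ` {..<j})"
      proof (cases "u = b")
        case False
        hence "h u \<le> h a" using deviation_eqD(2)[OF dev le] u a by simp
        hence "k \<le> j" using le_iff[of j k] k a j by simp
        moreover have "k \<noteq> j" using u k no_self_N by auto
        ultimately show ?thesis using k by auto
      qed (simp add: b)
    next
      fix u assume "u \<in> insert (w (j + 1)) (w ` {..<j})"
      then consider "u = b" | i where "i < j" "u = w i" unfolding b by auto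
      thus "u \<in> N (w j)"
      proof cases
        case 1 thus ?thesis using ab(4) a by simp
      next
        case 2
        thus ?thesis using deviation_eqD(1)[OF dev le, of u] strict[of j i] w_in[of i] a j by simp
      qed
    qed
  qed
  have at_s: "N (w z) = insert (w (z + 1)) (w ` {..<z})"
  proof -
    let ?e = "mean h s"
    obtain b where b: "b \<in> N s" "h (w (z + 1)) \<le> h b" using ex_exit_from_s .
    have e_le: "?e \<le> h (w (z + 1))" using ex(2) escape_pos by (simp add: algebra_simps)
    have "N s \<subseteq> V - {s}" using N_subset no_self_N by auto
    moreover have "finite (V - {s})" using finite_V by simp
    ultimately have dev: "finite (V - {s})" "N s \<subseteq> V - {s}" "(\<Sum>u\<in>N s. ?e - h u) = 0" "b \<in> N s"
      using sum_mean_deviation[OF sV] b(1) by auto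
    have S: "(\<Sum>u\<in>V - {s}. max 0 (?e - h u)) = h (w (z + 1)) - ?e"
      using sum_excess_s[OF e_le] escape_pos ex(2) by (simp add: algebra_simps)
    have "h b = h (w (z + 1))" using deviation_le[OF dev] S b(2) by simp
    moreover obtain k where k: "k < n" "b = w k" using index b(1) N_subset by blast
    ultimately have b': "b = w (z + 1)" using eq_iff[of "z + 1" k] z_less by simp
    have le: "(\<Sum>u\<in>V - {s}. max 0 (?e - h u)) \<le> h b - ?e" unfolding S b' by simp
    show ?thesis unfolding wz
    proof (intro subset_antisym subsetI)
      fix u assume u: "u \<in> N s"
      obtain k where k: "k < n" "u = w k" using index u N_subset by blast
      show "u \<in> insert (w (z + 1)) (w ` {..<z})"
      proof (cases "u = b")
        case False
        hence "h u \<le> h (w (z + 1))" using deviation_eqD(2)[OF dev le] u e_le by force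
        hence "k \<le> z + 1" using le_iff[of "z + 1" k] k z_less by simp
        moreover have "k \<noteq> z" using u k no_self_N wz by auto
        ultimately show ?thesis using k by (cases "k = z + 1") auto
      qed (simp add: b')
    next
      fix u assume "u \<in> insert (w (z + 1)) (w ` {..<z})"
      then consider "u = b" | i where "i < z" "u = w i" unfolding b' by auto
      thus "u \<in> N s"
      proof cases
        case 2
        hence "u \<noteq> s" using w_eq_iff[of i z] wz zn by auto
        thus ?thesis using deviation_eqD(1)[OF dev le, of u] 2 zero[of i] w_in[of i] zn escape_pos by simp
      qed (use b in simp)
    qed
  qed
  have zeros: "u \<in> {w 0, w 1}" if u: "u \<in> V" "h u = 0" for u
  proof -
    obtain k where k: "k < n" "u = w k" using index u(1) by blast
    hence "k \<le> z" using zero[of k] u by simp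
    hence "k = 0 \<or> k = 1" using ex(1) by auto
    thus ?thesis using k by auto
  qed
  \<comment> \<open>For \<open>z = 1\<close> the vertex \<open>w 0\<close> is a harmonic zero other than \<open>s\<close>, so it can only lead to \<open>s = w 1\<close>.\<close>
  have start: "N (w 0) = {w 1}"
  proof (cases "z = 0")
    case True thus ?thesis using at_s by simp
  next
    case False
    hence z: "z = 1" using ex(1) by simp
    have w0: "w 0 \<in> V" "h (w 0) = 0" "w 0 \<noteq> s"
      using w_in[of 0] zero[of 0] w_eq_iff[of 0 1] wz n3 z by auto
    moreover have "w 0 \<noteq> t" using w0(2) ht by auto
    ultimately have "mean h (w 0) = 0" using harm[of "w 0"] by auto
    hence "h v = 0" if "v \<in> N (w 0)" for v using mean_eq_0D[of h "w 0" v] h0 w0 that by auto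
    hence "N (w 0) \<subseteq> {w 0, w 1}" using zeros N_subset by blast
    thus ?thesis using no_self_N[of "w 0"] N_nonempty[OF w0(1)] by blast
  qed
  have t: "t = w (n - 1)"
  proof -
    obtain k where k: "k < n" "t = w k" using index[OF tV] .
    thus ?thesis using eq_iff[of "n - 1" k] h_last ht z_less by simp
  qed
  have "h v = 0" if "v \<in> N t" for v using mean_eq_0D[of h t v] h0 tV mt that by auto
  hence stop: "N (w (n - 1)) \<subseteq> {w 0, w 1}" using zeros N_subset t by blast
  have "N (w j) = insert (w (j + 1)) (w ` {..<j})" if "1 \<le> j" "j + 1 < n" for j
  proof (cases "j = z")
    case True thus ?thesis using at_s by simp
  next
    case False
    hence "z < j" using that ex(1) by auto
    thus ?thesis using inner that by blast
  qed
  thus ?thesis using start stop bij unfolding staircase_def n_def by auto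
qed

end

lemma max_ratio_ge: "3 \<le> n \<Longrightarrow> 2 \<le> max_ratio n"
proof -
  assume n: "3 \<le> n"
  define m where "m = n - 3"
  have "(0::real) \<le> (\<Sum>j<m. fact (Suc (Suc j) + 1))" by (intro sum_nonneg) simp
  moreover have "n - 1 = Suc (Suc m)" using n by (simp add: m_def)
  ultimately show ?thesis unfolding max_ratio_def
    by (simp add: sum.lessThan_Suc_shift numeral_2_eq_2 del: sum.lessThan_Suc)
qed

text \<open>
  The balance identity gives \<open>\<phi> s / \<phi> t = (1 - mean h t) / mean h s\<close>. The quotient is maximal only if
  the escape probability is minimal and every out-neighbour of \<open>t\<close> is a zero of \<open>h\<close>.
\<close>

lemma perron_quotient:
  assumes n: "3 \<le> card V" and st: "s \<in> V" "t \<in> V"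
  shows "perron_vector D s / perron_vector D t \<le> max_ratio (card V)"
    and "perron_vector D s / perron_vector D t = max_ratio (card V) \<Longrightarrow> \<exists>w. staircase w"
proof -
  let ?\<phi> = "perron_vector D" and ?M = "max_ratio (card V)"
  have pos: "0 < ?\<phi> s" "0 < ?\<phi> t" using perron_vector_pos st by auto
  have M: "2 \<le> ?M" using max_ratio_ge[OF n] .
  have "?\<phi> s / ?\<phi> t \<le> ?M \<and> (?\<phi> s / ?\<phi> t = ?M \<longrightarrow> (\<exists>w. staircase w))"
  proof (cases "s = t")
    case True thus ?thesis using M pos by simp
  next
    case False
    obtain h where h: "h s = 0" "h t = 1" "\<And>u. u \<in> V \<Longrightarrow> 0 \<le> h u" "\<And>u. u \<in> V \<Longrightarrow> h u \<le> 1"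
        "\<And>u. u \<in> V \<Longrightarrow> u \<noteq> s \<Longrightarrow> u \<noteq> t \<Longrightarrow> mean h u = h u"
      using escape_function_exists[OF st False] by blast
    obtain w z where w: "bij_betw w {..<card V} V" "w z = s" "z < card V"
        "\<And>i j. i \<le> j \<Longrightarrow> j < card V \<Longrightarrow> h (w i) \<le> h (w j)"
        "\<And>j. j < card V \<Longrightarrow> h (w j) = 0 \<longleftrightarrow> j \<le> z"
      using sorted_enumeration[of V s h] finite_V st(1) h(1,3) by blast
    note prems = n st h w
    let ?e = "mean h s"
    have bal: "?\<phi> s * ?e = ?\<phi> t * (1 - mean h t)"
      using perron_balance_two[OF st False, of h] h(1,2,5) by simp
    have e: "1 \<le> ?e * ?M" "0 < ?e" using escape_lower_bound[OF prems] escape_pos[OF prems] by auto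
    have mt: "0 \<le> mean h t" using mean_mono[of "\<lambda>_. 0" h t] mean_const[OF st(2), of 0] h(3) by simp
    have "?\<phi> s * ?e \<le> ?\<phi> t * (?M * ?e)"
      unfolding bal using e mt pos by (intro mult_left_mono) (auto simp: mult.commute)
    hence le: "?\<phi> s \<le> ?\<phi> t * ?M" using e(2) by (simp add: mult.assoc[symmetric])
    moreover have "\<exists>w. staircase w" if "?\<phi> s / ?\<phi> t = ?M"
    proof -
      have "?\<phi> s = ?M * ?\<phi> t" using that pos by (simp add: field_simps)
      hence "?\<phi> t * (?e * ?M) = ?\<phi> t * (1 - mean h t)" using bal by (simp add: mult_ac)
      hence "?e * ?M = 1 - mean h t" using pos by simp
      hence "?e * ?M = 1" "mean h t = 0" using e mt by auto
      thus ?thesis using staircase_if_minimal_escape[OF prems] by blast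
    qed
    ultimately show ?thesis using pos by (simp add: field_simps)
  qed
  thus "?\<phi> s / ?\<phi> t \<le> ?M" "?\<phi> s / ?\<phi> t = ?M \<Longrightarrow> \<exists>w. staircase w" by auto
qed

lemma principal_ratio_attained:
  "\<exists>s\<in>V. \<exists>t\<in>V. principal_ratio D = perron_vector D s / perron_vector D t"
proof -
  have ne: "perron_vector D ` V \<noteq> {}" "finite (perron_vector D ` V)"
    using two_vertices finite_V by auto
  obtain s where "s \<in> V" "Max (perron_vector D ` V) = perron_vector D s"
    using Max_in[OF ne(2,1)] by auto
  moreover obtain t where "t \<in> V" "Min (perron_vector D ` V) = perron_vector D t"
    using Min_in[OF ne(2,1)] by auto
  ultimately show ?thesis unfolding principal_ratio_def by auto
qed

lemma perron_quotient_le_principal_ratio: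
  assumes "s \<in> V" "t \<in> V"
  shows "perron_vector D s / perron_vector D t \<le> principal_ratio D"
proof -
  let ?P = "perron_vector D ` V"
  have f: "finite ?P" using finite_V by simp
  have "Min ?P \<in> ?P" using f assms by (intro Min_in) auto
  hence "0 < Min ?P" using perron_vector_pos by auto
  thus ?thesis unfolding principal_ratio_def using assms f perron_vector_pos[OF assms(1)]
    by (intro frac_le) (auto intro: Max_ge Min_le order_trans[OF less_imp_le Max_ge])
qed

lemma principal_ratio_le:
  assumes "3 \<le> card V" shows "principal_ratio D \<le> max_ratio (card V)"
  using principal_ratio_attained perron_quotient(1)[OF assms] by auto

lemma staircase_if_max:
  assumes "3 \<le> card V" "principal_ratio D = max_ratio (card V)"
  shows "\<exists>w. staircase w"
proof -
  obtain s t where "s \<in> V" "t \<in> V" "principal_ratio D = perron_vector D s / perron_vector D t"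
    using principal_ratio_attained by blast
  thus ?thesis using perron_quotient(2)[OF assms(1)] assms(2) by simp
qed

end

section \<open>Isomorphic digraphs\<close>

lemma walk_digraphI:
  assumes "D \<in> sc_digraphs n" "3 \<le> n" shows "walk_digraph D"
  using assms by (simp add: sc_digraphs_def walk_digraph_def)

text \<open>
  The stationary vector of the second digraph, pulled back along the isomorphism, is stationary for the
  first, so uniqueness identifies the two vectors.
\<close>

lemma principal_ratio_cong:
  assumes D: "walk_digraph D" and D': "walk_digraph D'"
    and g: "bij_betw g (pverts D) (pverts D')"
    and arcs: "\<And>u v. u \<in> pverts D \<Longrightarrow> v \<in> pverts D \<Longrightarrow> (g u, g v) \<in> parcs D' \<longleftrightarrow> (u, v) \<in> parcs D"
  shows "principal_ratio D = principal_ratio D'"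
proof -
  interpret D: walk_digraph D by fact
  interpret D': walk_digraph D' by fact
  have inj: "inj_on g (pverts D)" and img: "pverts D' = g ` pverts D" using g by (auto simp: bij_betw_def)
  have N: "D'.N (g u) = g ` D.N u" if "u \<in> pverts D" for u
    using D'.N_subset[of "g u"] D.N_subset[of u] arcs[OF that] unfolding img by blast
  have "card (D'.N (g u)) = card (D.N u)" if "u \<in> pverts D" for u
    unfolding N[OF that] using D.N_subset inj by (metis card_image inj_on_subset)
  hence rw: "rw_prob D' (g u) (g v) = rw_prob D u v" if "u \<in> pverts D" "v \<in> pverts D" for u v
    using that arcs unfolding D.rw_prob_eq D'.rw_prob_eq by simp
  have sum: "(\<Sum>u\<in>pverts D'. f u) = (\<Sum>u\<in>pverts D. f (g u))" for f :: "'b \<Rightarrow> real"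
    using sum.reindex_bij_betw[OF g, of f] by simp
  let ?\<phi> = "perron_vector D'"
  have st: "(\<Sum>u\<in>pverts D. ?\<phi> (g u) * rw_prob D u v) = ?\<phi> (g v)" if "v \<in> pverts D" for v
  proof -
    have "g v \<in> pverts D'" using that img by simp
    hence "?\<phi> (g v) = (\<Sum>u\<in>pverts D. ?\<phi> (g u) * rw_prob D' (g u) (g v))"
      using D'.perron_vector unfolding is_perron_vector_def sum by simp
    thus ?thesis using rw that by simp
  qed
  have "(\<Sum>u\<in>pverts D. ?\<phi> (g u)) = 1"
    using D'.perron_vector sum[of ?\<phi>] by (simp add: is_perron_vector_def)
  hence "is_perron_vector D (?\<phi> \<circ> g)"
    using D'.perron_vector_pos st img unfolding is_perron_vector_def by simp
  hence "perron_vector D u = ?\<phi> (g u)" if "u \<in> pverts D" for u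
    using D.perron_unique[OF D.perron_vector _ that] by simp
  hence "perron_vector D ` pverts D = ?\<phi> ` pverts D'" unfolding img image_image by simp
  thus ?thesis by (simp add: principal_ratio_def)
qed

text \<open>
  The maximum is taken over infinitely many digraphs, and \<open>Max\<close> carries information only for finite
  sets. By isomorphism invariance the ratio is determined by the arc set after a relabelling of the
  vertices by \<open>0, \<dots>, n - 1\<close>, and there are finitely many such arc sets.
\<close>

lemma finite_principal_ratios:
  assumes "3 \<le> n"
  shows "finite (principal_ratio ` (sc_digraphs n :: 'a pair_pre_digraph set))"
proof -
  let ?A = "sc_digraphs n :: 'a pair_pre_digraph set"
  have "\<exists>f. bij_betw f {..<n} (pverts D)" if "D \<in> ?A" for D
  proof -
    interpret walk_digraph D using walk_digraphI[OF that assms] .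
    show ?thesis using that ex_bij_betw_nat_finite[OF finite_V]
      by (auto simp: sc_digraphs_def atLeast0LessThan)
  qed
  then obtain f where f: "\<And>D. D \<in> ?A \<Longrightarrow> bij_betw (f D) {..<n} (pverts D)" by metis
  \<comment> \<open>The arc set of \<open>D\<close> after relabelling; digraphs with the same code are isomorphic.\<close>
  define c where "c D = {(i, j). i < n \<and> j < n \<and> (f D i, f D j) \<in> parcs D}" for D
  have eq: "principal_ratio D = principal_ratio D'" if "D \<in> ?A" "D' \<in> ?A" "c D = c D'" for D D'
  proof (rule principal_ratio_cong)
    let ?b = "the_inv_into {..<n} (f D)"
    have b: "bij_betw ?b (pverts D) {..<n}" using f[OF that(1)] by (rule bij_betw_the_inv_into)
    have fb: "f D (?b u) = u" "?b u < n" if "u \<in> pverts D" for u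
      using f[OF \<open>D \<in> ?A\<close>] that b by (auto simp: bij_betw_def f_the_inv_into_f)
    show "bij_betw (f D' \<circ> ?b) (pverts D) (pverts D')" using b f[OF that(2)] by (rule bij_betw_trans)
    fix u v assume uv: "u \<in> pverts D" "v \<in> pverts D"
    have "(?b u, ?b v) \<in> c D \<longleftrightarrow> (?b u, ?b v) \<in> c D'" using that(3) by simp
    thus "((f D' \<circ> ?b) u, (f D' \<circ> ?b) v) \<in> parcs D' \<longleftrightarrow> (u, v) \<in> parcs D"
      using fb uv by (simp add: c_def)
  qed (use that walk_digraphI[OF _ assms] in auto)
  have "c ` ?A \<subseteq> Pow ({..<n} \<times> {..<n})" by (auto simp: c_def)
  hence fin: "finite (c ` ?A)" by (rule finite_subset) simp
  have "principal_ratio ` ?A \<subseteq> (\<lambda>k. principal_ratio (SOME D. D \<in> ?A \<and> c D = k)) ` c ` ?A"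
  proof
    fix r assume "r \<in> principal_ratio ` ?A"
    then obtain D where D: "D \<in> ?A" "r = principal_ratio D" by blast
    define D' where "D' = (SOME D'. D' \<in> ?A \<and> c D' = c D)"
    have "D' \<in> ?A \<and> c D' = c D" unfolding D'_def
      by (rule someI[of "\<lambda>D'. D' \<in> ?A \<and> c D' = c D" D]) (simp add: D(1))
    hence "r = principal_ratio D'" using eq D by metis
    thus "r \<in> (\<lambda>k. principal_ratio (SOME D. D \<in> ?A \<and> c D = k)) ` c ` ?A"
      using D(1) unfolding D'_def by blast
  qed
  thus ?thesis using fin finite_subset by blast
qed

section \<open>The extremal digraphs\<close>

text \<open>
  The escape function of the extremal digraphs from vertex \<open>2\<close> to vertex \<open>n\<close>, scaled to avoid
  denominators: each increment in the local inequality is as large as it can be.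
\<close>

definition extremal_potential :: "nat \<Rightarrow> real" where
  "extremal_potential j = (if j \<le> 2 then 0 else \<Sum>i<j-1. fact (i + 1))"

text \<open>
  The mean value property at an inner vertex \<open>j\<close>, whose out-neighbours are \<open>1, \<dots>, j - 1\<close> and \<open>j + 1\<close>.
\<close>

lemma sum_extremal_potential:
  assumes "3 \<le> j"
  shows "(\<Sum>i=1..<j. extremal_potential i) + extremal_potential (j + 1) = j * extremal_potential j"
  using assms
proof (induction j rule: dec_induct)
  case base
  show ?case by (simp add: extremal_potential_def eval_nat_numeral)
next
  case (step j)
  then obtain k where k: "j = Suc k" by (cases j) auto
  have a: "extremal_potential (Suc j) = extremal_potential j + fact j"
    and b: "extremal_potential (Suc j + 1) = extremal_potential (Suc j) + fact (Suc j)"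
    using step.hyps by (simp_all add: extremal_potential_def k)
  have "(\<Sum>i=1..<Suc j. extremal_potential i) = (\<Sum>i=1..<j. extremal_potential i) + extremal_potential j"
    using step.hyps by simp
  thus ?case using step.IH unfolding b by (simp add: a algebra_simps)
qed

text \<open>
  All three digraphs are treated at once: the last vertex points to a non-empty set of vertices among
  \<open>1\<close> and \<open>2\<close>, at both of which the potential vanishes.
\<close>

context
  fixes n :: nat and S :: "(nat \<times> nat) set"
  assumes n3: "3 \<le> n" and S: "S \<subseteq> {(n, 1), (n, 2)}" "S \<noteq> {}"
begin

abbreviation "E \<equiv> extremal_digraph n S"

lemma extremal_out:
  assumes "1 \<le> j" "j < n"
  shows "parcs E `` {j} = insert (j + 1) {1..<j}"
  using assms S by (auto simp: extremal_digraph_def)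

lemma extremal_out_last: "parcs E `` {n} = S `` {n}"
  using n3 by (auto simp: extremal_digraph_def)

lemma extremal_vertices: "pverts E = {1..n}"
  by (simp add: extremal_digraph_def)

lemma extremal_arcs_subset: "parcs E \<subseteq> {1..n} \<times> {1..n}"
  using n3 S by (auto simp: extremal_digraph_def)

lemma pair_digraph_extremal: "pair_digraph E"
proof
  show "finite (pverts E)" by (simp add: extremal_vertices)
  show "finite (parcs E)" using extremal_arcs_subset by (rule finite_subset) simp
  show "fst e \<in> pverts E" "snd e \<in> pverts E" if "e \<in> parcs E" for e
    using that extremal_arcs_subset by (auto simp: extremal_vertices)
  show "fst e \<noteq> snd e" if "e \<in> parcs E" for e
    using that S n3 by (auto simp: extremal_digraph_def)
qed

lemma strongly_connected_extremal: "strongly_connected (with_proj E)"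
proof -
  interpret pair_digraph E by (rule pair_digraph_extremal)
  have arc: "i \<rightarrow>\<^sup>*\<^bsub>with_proj E\<^esub> j" if "(i, j) \<in> parcs E" for i j
    using that by (intro reachable_adjI) simp
  have up: "i \<rightarrow>\<^sup>*\<^bsub>with_proj E\<^esub> j" if "i \<le> j" "1 \<le> i" "j \<le> n" for i j
    using that
  proof (induction j rule: dec_induct)
    case base
    thus ?case by (simp add: extremal_vertices)
  next
    case (step j)
    have "Suc j \<in> parcs E `` {j}" using step by (subst extremal_out) auto
    hence "(j, Suc j) \<in> parcs E" by (simp only: Image_singleton_iff)
    moreover have "i \<rightarrow>\<^sup>*\<^bsub>with_proj E\<^esub> j" using step by simp
    ultimately show ?case using reachable_trans[OF _ arc] by blast
  qed
  have n1: "n \<rightarrow>\<^sup>*\<^bsub>with_proj E\<^esub> 1"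
  proof (cases "(n, 1) \<in> S")
    case True
    thus ?thesis by (intro arc) (simp add: extremal_digraph_def)
  next
    case False
    hence "(n, 2) \<in> S" using S by auto
    hence "(n, 2) \<in> parcs E" by (simp add: extremal_digraph_def)
    moreover have "1 \<in> parcs E `` {2}" using n3 by (subst extremal_out) auto
    hence "(2, 1) \<in> parcs E" by (simp only: Image_singleton_iff)
    ultimately show ?thesis by (intro reachable_trans[OF arc arc])
  qed
  show ?thesis
  proof (rule strongly_connectedI)
    show "verts (with_proj E) \<noteq> {}" using n3 by (simp add: extremal_vertices)
    fix i j assume "i \<in> verts (with_proj E)" "j \<in> verts (with_proj E)"
    hence "i \<rightarrow>\<^sup>*\<^bsub>with_proj E\<^esub> n" "1 \<rightarrow>\<^sup>*\<^bsub>with_proj E\<^esub> j"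
      by (auto simp: extremal_vertices intro: up)
    thus "i \<rightarrow>\<^sup>*\<^bsub>with_proj E\<^esub> j" by (rule reachable_trans[OF reachable_trans[OF _ n1]])
  qed
qed

lemma extremal_in_sc_digraphs: "E \<in> sc_digraphs n"
  using pair_digraph_extremal strongly_connected_extremal by (simp add: sc_digraphs_def extremal_vertices)

text \<open>
  The balance identity with the explicit potential evaluates the quotient of the stationary
  probabilities of \<open>2\<close> and \<open>n\<close>. It bounds the principal ratio from below, and the general bound
  shows that no other quotient is larger.
\<close>

lemma extremal_principal_ratio: "principal_ratio E = max_ratio n"
proof -
  interpret walk_digraph E using walk_digraphI[OF extremal_in_sc_digraphs n3] .
  let ?h = extremal_potential and ?\<phi> = "perron_vector E"
  have mean: "mean ?h j = ((\<Sum>i=1..<j. ?h i) + ?h (j + 1)) / j" if "1 \<le> j" "j < n" for j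
    unfolding mean_def extremal_out[OF that] using that by simp
  have "mean ?h j = ?h j" if "j \<in> V" "j \<noteq> 2" "j \<noteq> n" for j
  proof (cases "j = 1")
    case True
    thus ?thesis using mean[of 1] n3 by (simp add: extremal_potential_def)
  next
    case False
    hence "3 \<le> j" "j < n" using that by (auto simp: extremal_vertices)
    thus ?thesis using mean[of j] sum_extremal_potential[of j] by simp
  qed
  hence "?\<phi> 2 * (mean ?h 2 - ?h 2) = ?\<phi> n * (?h n - mean ?h n)"
    using n3 by (intro perron_balance_two) (auto simp: extremal_vertices)
  moreover have "mean ?h 2 = 3 / 2" "?h 2 = 0"
    using mean[of 2] n3 by (simp_all add: extremal_potential_def eval_nat_numeral)
  moreover have "?h j = 0" if "j \<in> N n" for j
    using that S unfolding extremal_out_last by (auto simp: extremal_potential_def)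
  hence "mean ?h n = 0" by (simp add: mean_def)
  moreover have "?h n = 3 / 2 * max_ratio n"
    using n3 by (simp add: extremal_potential_def max_ratio_def)
  ultimately have "?\<phi> 2 = ?\<phi> n * max_ratio n" by simp
  moreover have V: "2 \<in> V" "n \<in> V" using n3 by (auto simp: extremal_vertices)
  ultimately have "?\<phi> 2 / ?\<phi> n = max_ratio n"
    using perron_vector_pos[OF V(2)] by (simp add: field_simps)
  hence "max_ratio n \<le> principal_ratio E" using perron_quotient_le_principal_ratio[OF V] by simp
  moreover have "principal_ratio E \<le> max_ratio n" using principal_ratio_le n3 by (simp add: extremal_vertices)
  ultimately show ?thesis by simp
qed

end

section \<open>Recognising the extremal digraphs\<close>

lemma digraph_iso_relabel:
  assumes "pair_digraph D" "inj_on g (pverts D)" "pverts D' = g ` pverts D"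
    "parcs D' = map_prod g g ` parcs D"
  shows "digraph_iso (with_proj D) (with_proj D')"
proof -
  interpret pair_digraph D by fact
  define f where "f = \<lparr>iso_verts = g, iso_arcs = map_prod g g, iso_head = snd, iso_tail = fst\<rparr>"
  have sub: "parcs D \<subseteq> pverts D \<times> pverts D" using in_arcsD1 in_arcsD2 by auto
  have "inj_on (map_prod g g) (parcs D)"
    using map_prod_inj_on[OF assms(2,2)] sub by (rule inj_on_subset)
  hence "pre_digraph.digraph_isomorphism (with_proj D) f"
    using assms(2) wf_digraph_axioms
    by (auto simp: pre_digraph.digraph_isomorphism_def f_def)
  moreover have "with_proj D' = app_iso f (with_proj D)"
    using assms by (simp add: app_iso_def f_def with_proj_def)
  ultimately show ?thesis unfolding digraph_iso_def by blast
qed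

lemma (in walk_digraph) staircase_iso:
  assumes "3 \<le> card V" "staircase w"
  shows "\<exists>S \<subseteq> {(card V, 1), (card V, 2)}. S \<noteq> {} \<and>
           digraph_iso (with_proj D) (with_proj (extremal_digraph (card V) S))"
proof -
  define n where "n = card V"
  have n3: "3 \<le> n" using assms by (simp add: n_def)
  have w: "bij_betw w {..<n} V" "N (w 0) = {w 1}" "N (w (n - 1)) \<subseteq> {w 0, w 1}"
    "\<And>j. 1 \<le> j \<Longrightarrow> j + 1 < n \<Longrightarrow> N (w j) = insert (w (j + 1)) (w ` {..<j})"
    using assms(2) unfolding staircase_def n_def by auto
  define g where "g = Suc \<circ> the_inv_into {..<n} w"
  have gw: "g (w j) = Suc j" if "j < n" for j
    using w(1) that by (simp add: g_def bij_betw_def the_inv_into_f_f)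
  have inj: "inj_on g V"
    unfolding g_def using bij_betw_the_inv_into[OF w(1)] by (auto simp: bij_betw_def intro: comp_inj_on)
  have gV: "g ` V = {1..n}"
  proof -
    have "g ` V = (\<lambda>j. g (w j)) ` {..<n}" using w(1) by (simp add: bij_betw_def image_image[symmetric])
    also have "\<dots> = Suc ` {..<n}" using gw by simp
    also have "\<dots> = {1..n}" by (simp add: image_Suc_lessThan)
    finally show ?thesis .
  qed
  define S where "S = Pair n ` g ` N (w (n - 1))"
  have last: "w (n - 1) \<in> V" using w(1) n3 by (auto simp: bij_betw_def)
  have "g ` N (w (n - 1)) \<subseteq> g ` {w 0, w 1}" using w(3) by (rule image_mono)
  also have "\<dots> = {1, 2}" using gw[of 0] gw[of 1] n3 by auto
  finally have S: "S \<subseteq> {(n, 1), (n, 2)}" by (auto simp: S_def)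
  have S0: "S \<noteq> {}" using N_nonempty[OF last] by (simp add: S_def)
  let ?E = "extremal_digraph n S"
  have out: "parcs ?E `` {g u} = g ` N u" if u: "u \<in> V" for u
  proof -
    obtain j where j: "j < n" "u = w j" using w(1) u by (auto simp: bij_betw_def)
    consider "j = 0" | "1 \<le> j" "j + 1 < n" | "j = n - 1" using j by linarith
    thus ?thesis
    proof cases
      case 1
      thus ?thesis using extremal_out[OF n3 S S0, of 1] j w(2) gw[of 0] gw[of 1] n3 by auto
    next
      case 2
      have "g ` N u = insert (j + 2) ((\<lambda>i. g (w i)) ` {..<j})"
        unfolding j(2) w(4)[OF 2] using gw[of "j + 1"] 2 by (simp add: image_image)
      also have "(\<lambda>i. g (w i)) ` {..<j} = Suc ` {..<j}" using gw j(1) by (intro image_cong) auto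
      finally show ?thesis using extremal_out[OF n3 S S0, of "j + 1"] 2 gw[OF j(1)] j(2)
        by (simp add: image_Suc_lessThan atLeastLessThanSuc_atLeastAtMost)
    next
      case 3
      have "g u = n" using 3 gw[OF j(1)] j(2) n3 by simp
      thus ?thesis using extremal_out_last[OF n3 S S0] 3 j(2) by (auto simp: S_def)
    qed
  qed
  have "parcs ?E = map_prod g g ` parcs D"
  proof (intro subset_antisym subrelI)
    fix a b assume ab: "(a, b) \<in> parcs ?E"
    hence "a \<in> g ` V" using extremal_arcs_subset[OF n3 S S0] gV by auto
    then obtain u where "u \<in> V" "a = g u" by blast
    thus "(a, b) \<in> map_prod g g ` parcs D" using out[of u] ab by force
  next
    fix a b assume "(a, b) \<in> map_prod g g ` parcs D"
    then obtain u v where uv: "(u, v) \<in> parcs D" "a = g u" "b = g v" by auto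
    have "u \<in> V" using uv(1) digraph by (auto simp: pair_digraph_def pair_fin_digraph_def pair_wf_digraph_def)
    thus "(a, b) \<in> parcs ?E" using out[of u] uv by auto
  qed
  hence "digraph_iso (with_proj D) (with_proj ?E)"
    using digraph_iso_relabel[OF digraph inj] gV by (simp add: extremal_digraph_def)
  thus ?thesis using S S0 unfolding n_def by blast
qed

section \<open>The maximum and where it is attained\<close>

text \<open>
  The two largest terms combine: \<open>(n - 1)! + (n - 2)! = n / (n - 1) * (n - 1)!\<close>.
\<close>

lemma max_ratio_closed_form:
  assumes "3 \<le> n"
  shows "max_ratio n = 2 / 3 * (real n / real (n - 1) + 1 / fact (n - 1) * (\<Sum>i=1..n-3. fact i)) * fact (n - 1)"
proof -
  define m where "m = n - 3"
  have n: "n = m + 3" using assms by (simp add: m_def)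
  have f: "fact (m + 2) = (real m + 2) * fact (m + 1)" by (simp add: algebra_simps)
  have n1: "n - 1 = m + 2" "real n = real m + 3" "real (m + 2) = real m + 2" using n by auto
  have "real n / real (n - 1) * fact (n - 1) = (real m + 3) * fact (m + 1)"
    unfolding n1 f by (simp del: fact_Suc)
  also have "\<dots> = fact (m + 2) + fact (m + 1)" unfolding f by (simp add: algebra_simps)
  finally have "real n / real (n - 1) * fact (n - 1) + (\<Sum>i=1..n-3. fact i) = (\<Sum>j<n-1. fact (j + 1))"
    using sum.atLeast1_atMost_eq[of "fact :: nat \<Rightarrow> real" m] by (simp add: n del: fact_Suc)
  thus ?thesis unfolding max_ratio_def by (simp add: distrib_left distrib_right mult.assoc)
qed

theorem theorem2:
  fixes n :: nat
  assumes "n \<ge> 3"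
  shows "max_principal_ratio n =
           2 / 3 * (real n / real (n - 1) + 1 / fact (n - 1) * (\<Sum>i=1..n-3. fact i)) * fact (n - 1)
       \<and> (\<forall>D\<in>{D1 n, D2 n, D3 n}. D \<in> sc_digraphs n \<and> principal_ratio D = max_principal_ratio n)
       \<and> (\<forall>D :: 'a pair_pre_digraph. D \<in> sc_digraphs n \<longrightarrow> principal_ratio D = max_principal_ratio n \<longrightarrow>
            digraph_iso (with_proj D) (with_proj (D1 n)) \<or>
            digraph_iso (with_proj D) (with_proj (D2 n)) \<or>
            digraph_iso (with_proj D) (with_proj (D3 n)))"
proof -
  have D: "D \<in> sc_digraphs n \<and> principal_ratio D = max_ratio n" if "D \<in> {D1 n, D2 n, D3 n}" for D
    using that extremal_in_sc_digraphs[OF assms] extremal_principal_ratio[OF assms]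
    by (auto simp: D1_def D2_def D3_def)
  have le: "principal_ratio D \<le> max_ratio n" if "D \<in> sc_digraphs n" for D :: "'b pair_pre_digraph"
    using walk_digraph.principal_ratio_le[OF walk_digraphI[OF that assms]] that assms
    by (simp add: sc_digraphs_def)
  have "max_ratio n \<in> principal_ratio ` (sc_digraphs n :: nat pair_pre_digraph set)"
    using D[of "D1 n"] by (auto intro: rev_image_eqI)
  hence max: "max_principal_ratio n = max_ratio n"
    unfolding max_principal_ratio_def
    using le by (intro Max_eqI finite_principal_ratios[OF assms]) auto
  have "digraph_iso (with_proj D) (with_proj (D1 n)) \<or>
        digraph_iso (with_proj D) (with_proj (D2 n)) \<or>
        digraph_iso (with_proj D) (with_proj (D3 n))"
    if D: "D \<in> sc_digraphs n" "principal_ratio D = max_ratio n" for D :: "'a pair_pre_digraph"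
  proof -
    interpret walk_digraph D using walk_digraphI[OF D(1) assms] .
    have n: "card (pverts D) = n" using D(1) by (simp add: sc_digraphs_def)
    obtain w where "staircase w" using staircase_if_max assms D(2) n by auto
    then obtain S where S: "S \<subseteq> {(n, 1), (n, 2)}" "S \<noteq> {}"
        "digraph_iso (with_proj D) (with_proj (extremal_digraph n S))"
      using staircase_iso assms unfolding n by blast
    have "S = {(n, 1)} \<or> S = {(n, 2)} \<or> S = {(n, 1), (n, 2)}" using S(1,2) by blast
    thus ?thesis using S(3) unfolding D1_def D2_def D3_def by auto
  qed
  thus ?thesis unfolding max max_ratio_closed_form[OF assms, symmetric] using D by blast
qed

end
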